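(* Let $D\subseteq\mathbb{R}^d$ be open, $f:D\to\mathbb{R}^d$ locally Lipschitz, and $x^*\in D$ an equilibrium of $\dot x=f(x)$. Let $\varepsilon>0$ and let $S\subset D$ be compact with $B_\varepsilon(x^* )\subset\mathrm{int}(S)$. If $V(x)=\|x-x^*\|$ is an $\varepsilon$-Strict Recurrent Lyapunov Function ($\varepsilon$-SRLF) over $S$ with parameter $\tau>0$, then $x^*$ is practically asymptotically stable on $S$ with precision $$\varepsilon':=\varepsilon+F_\varepsilon\,h(\tau;L),$$ where $F_\varepsilon:=\sup_{x\in B_\varepsilon(x^* )}\|f(x)\|$, $L:=L_{\mathrm{cl}\,\mathcal{R}^\tau(B_\varepsilon(x^* ))}$ is the one-sided Lipschitz constant of $f$ over $\mathrm{cl}\,\mathcal{R}^\tau(B_\varepsilon(x^* ))$, and $h(\tau;L)=(e^{L\tau}-1)/L$ if $L\neq0$, $h(\tau;0)=\tau$.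
   Context: $\|\cdot\|$ is a fixed norm on $\mathbb{R}^d$ and $B_r(x)$ is the closed ball of radius $r$ around $x$. Locally Lipschitz means: for every compact $K\subset D$ there is $\overline L_K\ge 0$ with $\|f(y)-f(x)\|\le \overline L_K\|y-x\|$ for all $x,y\in K$. For $x\in D$, $\phi(t,x)$ is the solution of $\dot x=f(x)$ with $\phi(0,x)=x$, on its maximal open interval of existence $I(x)\ni 0$. Assertions about $\phi(t,x)$ for all $t\ge0$ (or $t\to\infty$) include existence of the solution for all $t\ge0$. Weak pairing: the norm is equipped with an associated weak pairing $[\cdot;\cdot]:\mathbb{R}^d\times\mathbb{R}^d\to\mathbb{R}$, i.e. a map with (i) $[x_1+x_2;y]\le[x_1;y]+[x_2;y]$; (ii) $[\alpha x;y]=[x;\alpha y]=\alpha[x;y]$ for $\alpha>0$ and $[-x;-y]=[x;y]$; (iii) $[x;x]>0$ for $x\ne0$; (iv) $|[x;y]|\le[x;x]^{1/2}[y;y]^{1/2}$; such that $\|x\|=[x;x]^{1/2}$, and satisfying the curve norm derivative formula $\|x(t)\|\,D^+\|x(t)\|=[\dot x(t);x(t)]$ along differentiable curves, where $D^+\varphi(t)=\limsup_{h\to0^+}(\varphi(t+h)-\varphi(t))/h$. The one-sided Lipschitz constant of $f$ over a compact $K\subset D$ is the smallest $L_K\in\mathbb{R}$ with $[f(y)-f(x);y-x]\le L_K\|y-x\|^2$ for all $x,y\in K$. Reachable tube: $\mathcal{R}^\tau(A)=\{\phi(t,x): x\in A,\ t\in[0,\tau]\cap I(x)\}$. Containment times: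 $T_S(x;\tau):=\{t\in(0,\tau]: \phi(t,x)\in S\}$ (with $t\in I(x)$). An inequality $\min_{s\in T_S(x;\tau)}g(s)<c$ means that there is $s\in T_S(x;\tau)$ with $g(s)<c$. $\varepsilon$-SRLF: a continuous $V:D\to\mathbb{R}_{\ge0}$ is an $\varepsilon$-SRLF over $S$ with parameter $\tau$ if (i) $V(x^* )=0$ and $V(x)>0$ for all $x\in D\setminus\{x^*\}$; (ii) $\min_{s\in T_S(x;\tau)}V(\phi(s,x))<V(x)$ for all $x\in K_\varepsilon:=\mathrm{cl}(S\setminus B_\varepsilon(x^* ))$. Practically asymptotically stable on $S$ with precision $\varepsilon'>0$: (i) there is $\delta>0$ such that $\|x-x^*\|\le\delta$ implies $\|\phi(t,x)-x^*\|\le\varepsilon'$ for all $t\ge0$; and (ii) $\limsup_{t\to\infty}\|\phi(t,x)-x^*\|\le\varepsilon'$ for all $x\in S$. *)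

theory Defs
  imports "HOL-Analysis.Analysis"
begin

text \<open>
  The norm on \<open>\<real>\<^sup>d\<close> is an arbitrary function \<open>N\<close>, unrelated to the Euclidean \<^const>\<open>norm\<close> of the
  type. Topological notions and derivatives are those of the type; they do not depend on the
  choice of norm in finite dimension.
\<close>

definition vector_norm :: "(real ^ 'd \<Rightarrow> real) \<Rightarrow> bool" where
  "vector_norm N \<longleftrightarrow>
     (\<forall>x. 0 \<le> N x) \<and>
     (\<forall>x. N x = 0 \<longleftrightarrow> x = 0) \<and>
     (\<forall>c x. N (c *\<^sub>R x) = \<bar>c\<bar> * N x) \<and>
     (\<forall>x y. N (x + y) \<le> N x + N y)"

definition norm_ball :: "(real ^ 'd \<Rightarrow> real) \<Rightarrow> real ^ 'd \<Rightarrow> real \<Rightarrow> (real ^ 'd) set" where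
  "norm_ball N x r = {y. N (y - x) \<le> r}"

definition upper_right_dini :: "(real \<Rightarrow> real) \<Rightarrow> real \<Rightarrow> ereal" where
  "upper_right_dini g t = Limsup (at_right 0) (\<lambda>h. ereal ((g (t + h) - g t) / h))"

definition weak_pairing :: "(real ^ 'd \<Rightarrow> real ^ 'd \<Rightarrow> real) \<Rightarrow> bool" where
  "weak_pairing P \<longleftrightarrow>
     (\<forall>x\<^sub>1 x\<^sub>2 y. P (x\<^sub>1 + x\<^sub>2) y \<le> P x\<^sub>1 y + P x\<^sub>2 y) \<and>
     (\<forall>\<alpha> x y. \<alpha> > 0 \<longrightarrow> P (\<alpha> *\<^sub>R x) y = \<alpha> * P x y \<and> P x (\<alpha> *\<^sub>R y) = \<alpha> * P x y) \<and>
     (\<forall>x y. P (- x) (- y) = P x y) \<and>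
     (\<forall>x. x \<noteq> 0 \<longrightarrow> P x x > 0) \<and>
     (\<forall>x y. \<bar>P x y\<bar> \<le> sqrt (P x x) * sqrt (P y y))"

definition curve_norm_derivative_formula ::
  "(real ^ 'd \<Rightarrow> real) \<Rightarrow> (real ^ 'd \<Rightarrow> real ^ 'd \<Rightarrow> real) \<Rightarrow> bool" where
  "curve_norm_derivative_formula N P \<longleftrightarrow>
     (\<forall>c c' a b.
        (\<forall>t\<in>{a<..<b}. (c has_vector_derivative c' t) (at t)) \<longrightarrow>
        (\<forall>t\<in>{a<..<b}. ereal (N (c t)) * upper_right_dini (\<lambda>s. N (c s)) t = ereal (P (c' t) (c t))))"

definition associated_weak_pairing ::
  "(real ^ 'd \<Rightarrow> real) \<Rightarrow> (real ^ 'd \<Rightarrow> real ^ 'd \<Rightarrow> real) \<Rightarrow> bool" where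
  "associated_weak_pairing N P \<longleftrightarrow>
     weak_pairing P \<and> (\<forall>x. N x = sqrt (P x x)) \<and> curve_norm_derivative_formula N P"

definition locally_lipschitz ::
  "(real ^ 'd \<Rightarrow> real) \<Rightarrow> (real ^ 'd) set \<Rightarrow> (real ^ 'd \<Rightarrow> real ^ 'd) \<Rightarrow> bool" where
  "locally_lipschitz N D f \<longleftrightarrow>
     (\<forall>K. compact K \<and> K \<subseteq> D \<longrightarrow>
        (\<exists>L\<ge>0. \<forall>x\<in>K. \<forall>y\<in>K. N (f y - f x) \<le> L * N (y - x)))"

definition one_sided_lipschitz_constant ::
  "(real ^ 'd \<Rightarrow> real) \<Rightarrow> (real ^ 'd \<Rightarrow> real ^ 'd \<Rightarrow> real) \<Rightarrow> (real ^ 'd \<Rightarrow> real ^ 'd) \<Rightarrow>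
   (real ^ 'd) set \<Rightarrow> real" where
  "one_sided_lipschitz_constant N P f K =
     (LEAST L. \<forall>x\<in>K. \<forall>y\<in>K. P (f y - f x) (y - x) \<le> L * (N (y - x))\<^sup>2)"

definition ivp_solution ::
  "(real ^ 'd) set \<Rightarrow> (real ^ 'd \<Rightarrow> real ^ 'd) \<Rightarrow> real ^ 'd \<Rightarrow> real set \<Rightarrow> (real \<Rightarrow> real ^ 'd) \<Rightarrow> bool"
  where
  "ivp_solution D f x J u \<longleftrightarrow>
     open J \<and> is_interval J \<and> 0 \<in> J \<and> u 0 = x \<and>
     (\<forall>t\<in>J. u t \<in> D \<and> (u has_vector_derivative f (u t)) (at t))"

definition existence_interval ::
  "(real ^ 'd) set \<Rightarrow> (real ^ 'd \<Rightarrow> real ^ 'd) \<Rightarrow> real ^ 'd \<Rightarrow> real set" where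
  "existence_interval D f x = \<Union>{J. \<exists>u. ivp_solution D f x J u}"

text \<open>
  For locally Lipschitz \<open>f\<close>, \<open>D\<close> open and \<open>x \<in> D\<close>, the maximal solution exists and is unique on
  the existence interval. The value of \<open>flow D f t x\<close> for \<open>t\<close> outside that interval is
  meaningless, so every use below is guarded.
\<close>

definition flow ::
  "(real ^ 'd) set \<Rightarrow> (real ^ 'd \<Rightarrow> real ^ 'd) \<Rightarrow> real \<Rightarrow> real ^ 'd \<Rightarrow> real ^ 'd" where
  "flow D f t x = (SOME u. ivp_solution D f x (existence_interval D f x) u) t"

definition reachable_tube ::
  "(real ^ 'd) set \<Rightarrow> (real ^ 'd \<Rightarrow> real ^ 'd) \<Rightarrow> real \<Rightarrow> (real ^ 'd) set \<Rightarrow> (real ^ 'd) set" where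
  "reachable_tube D f \<tau> A =
     {flow D f t x |t x. x \<in> A \<and> t \<in> {0..\<tau>} \<inter> existence_interval D f x}"

definition containment_times ::
  "(real ^ 'd) set \<Rightarrow> (real ^ 'd \<Rightarrow> real ^ 'd) \<Rightarrow> (real ^ 'd) set \<Rightarrow> real ^ 'd \<Rightarrow> real \<Rightarrow> real set" where
  "containment_times D f S x \<tau> =
     {t \<in> {0<..\<tau>} \<inter> existence_interval D f x. flow D f t x \<in> S}"

definition eps_SRLF ::
  "(real ^ 'd \<Rightarrow> real) \<Rightarrow> (real ^ 'd) set \<Rightarrow> (real ^ 'd \<Rightarrow> real ^ 'd) \<Rightarrow> real ^ 'd \<Rightarrow> real \<Rightarrow>
   (real ^ 'd) set \<Rightarrow> real \<Rightarrow> (real ^ 'd \<Rightarrow> real) \<Rightarrow> bool" where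
  "eps_SRLF N D f xs \<epsilon> S \<tau> V \<longleftrightarrow>
     continuous_on D V \<and> (\<forall>x\<in>D. 0 \<le> V x) \<and>
     V xs = 0 \<and> (\<forall>x\<in>D - {xs}. V x > 0) \<and>
     (\<forall>x\<in>closure (S - norm_ball N xs \<epsilon>).
        \<exists>s\<in>containment_times D f S x \<tau>. V (flow D f s x) < V x)"

definition practically_asymptotically_stable ::
  "(real ^ 'd \<Rightarrow> real) \<Rightarrow> (real ^ 'd) set \<Rightarrow> (real ^ 'd \<Rightarrow> real ^ 'd) \<Rightarrow> real ^ 'd \<Rightarrow>
   (real ^ 'd) set \<Rightarrow> real \<Rightarrow> bool" where
  "practically_asymptotically_stable N D f xs S \<epsilon>' \<longleftrightarrow>
     \<epsilon>' > 0 \<and>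
     (\<exists>\<delta>>0. \<forall>x. N (x - xs) \<le> \<delta> \<longrightarrow>
        {0..} \<subseteq> existence_interval D f x \<and> (\<forall>t\<ge>0. N (flow D f t x - xs) \<le> \<epsilon>')) \<and>
     (\<forall>x\<in>S. {0..} \<subseteq> existence_interval D f x \<and>
        Limsup at_top (\<lambda>t. ereal (N (flow D f t x - xs))) \<le> ereal \<epsilon>')"

definition growth_factor :: "real \<Rightarrow> real \<Rightarrow> real" where
  "growth_factor \<tau> L = (if L = 0 then \<tau> else (exp (L * \<tau>) - 1) / L)"

end

theory Submission
  imports Defs
begin

text \<open>
  Every point of \<open>S\<close> returns to \<open>S\<close>: near \<open>x\<^sup>*\<close> by continuity, elsewhere by the SRLF condition. The
  times of visits to \<open>S\<close> form a closed set which therefore has no last element, so all solutions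
  starting in \<open>S\<close> are global. An orbit that starts in the ball \<open>B\<^sub>\<epsilon>(x\<^sup>*)\<close> and leaves it through a
  boundary point \<open>y\<close> is back within time \<open>\<tau>\<close>; meanwhile its distance \<open>w\<close> from \<open>y\<close> satisfies
  \<open>D\<^sup>+ w \<le> L w + F\<^sub>\<epsilon>\<close> with \<open>w(0) = 0\<close>, hence \<open>w \<le> F\<^sub>\<epsilon> h(\<tau>; L)\<close>. Finally every orbit from \<open>S\<close> reaches
  the ball: its \<open>\<omega>\<close>-limit set meets \<open>S\<close>, and by the SRLF condition a point of the intersection
  closest to \<open>x\<^sup>*\<close> has distance less than \<open>\<epsilon>\<close>.
\<close>

section \<open>Dini derivatives and Gronwall's inequality\<close>

lemma last_time_at_level:
  fixes g :: "real \<Rightarrow> real"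
  assumes g: "continuous_on {a..b} g" and "a \<le> b" "g a \<le> y" "y < g b"
  obtains t where "a \<le> t" "t < b" "g t = y" "\<And>s. t < s \<Longrightarrow> s \<le> b \<Longrightarrow> y < g s"
proof -
  have "compact ({a..b} \<inter> ({a..b} \<inter> g -` {..y}))"
    by (intro compact_Int_closed continuous_closed_preimage g) auto
  moreover have "a \<in> {a..b} \<inter> ({a..b} \<inter> g -` {..y})" using assms by simp
  ultimately obtain t where t: "t \<in> {a..b}" "g t \<le> y"
    and last: "\<And>s. s \<in> {a..b} \<Longrightarrow> g s \<le> y \<Longrightarrow> s \<le> t"
    using compact_attains_sup[of "{a..b} \<inter> ({a..b} \<inter> g -` {..y})"] by blast
  obtain t' where "t \<le> t'" "t' \<le> b" "g t' = y"
    using IVT'[of g t y b] t \<open>y < g b\<close> continuous_on_subset[OF g, of "{t..b}"] by auto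
  with last[of t'] t have "g t = y" by auto
  moreover have "t < b" using t \<open>y < g b\<close> by (cases "t = b") auto
  moreover have "y < g s" if "t < s" "s \<le> b" for s
    using last[of s] that t(1) by (cases "g s \<le> y") auto
  ultimately show thesis using that t(1) by auto
qed

lemma first_time_at_level:
  fixes g :: "real \<Rightarrow> real"
  assumes g: "continuous_on {a..b} g" and "a \<le> b" "g a < y" "y \<le> g b"
  obtains t where "a < t" "t \<le> b" "g t = y" "\<And>s. a \<le> s \<Longrightarrow> s < t \<Longrightarrow> g s < y"
proof -
  have "continuous_on {-b..-a} (\<lambda>s. - g (- s))"
    by (intro continuous_intros continuous_on_compose2[OF g]) auto
  then obtain t where t: "- b \<le> t" "t < - a" "g (- t) = y"
    and before: "\<And>s. t < s \<Longrightarrow> s \<le> - a \<Longrightarrow> g (- s) < y"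
    using last_time_at_level[of "- b" "- a" "\<lambda>s. - g (- s)" "- y"] assms(2-4) by auto
  show thesis
  proof (rule that)
    show "g s < y" if "a \<le> s" "s < - t" for s
      using before[of "- s"] that by simp
  qed (use t in auto)
qed

lemma continuity_bootstrap:
  fixes g :: "real \<Rightarrow> real"
  assumes g: "continuous_on {a..b} g" and "g a < r"
    and step: "\<And>t. t \<in> {a..b} \<Longrightarrow> (\<And>s. s \<in> {a..t} \<Longrightarrow> g s \<le> r) \<Longrightarrow> g t < r"
    and t: "t \<in> {a..b}"
  shows "g t < r"
proof (rule ccontr)
  assume "\<not> g t < r"
  then obtain t\<^sub>1 where t\<^sub>1: "a < t\<^sub>1" "t\<^sub>1 \<le> t" "g t\<^sub>1 = r"
    and before: "\<And>s. a \<le> s \<Longrightarrow> s < t\<^sub>1 \<Longrightarrow> g s < r"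
    using first_time_at_level[of a t g r] continuous_on_subset[OF g, of "{a..t}"] t \<open>g a < r\<close>
    by auto
  have "g s \<le> r" if "s \<in> {a..t\<^sub>1}" for s
    using before[of s] t\<^sub>1(3) that by (cases "s = t\<^sub>1") auto
  then show False using step[of t\<^sub>1] t\<^sub>1 t by simp
qed

lemma upper_right_dini_mono:
  assumes "\<forall>\<^sub>F h in at_right 0. (g (t + h) - g t) / h \<le> (g' (t' + h) - g' t') / h"
  shows "upper_right_dini g t \<le> upper_right_dini g' t'"
  unfolding upper_right_dini_def using assms by (auto intro!: Limsup_mono)

lemma has_vector_derivative_tendsto_at_right:
  assumes "(c has_vector_derivative c') (at t)"
  shows "((\<lambda>h. (c (t + h) - c t) /\<^sub>R h) \<longlongrightarrow> c') (at_right 0)"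
proof -
  have "((\<lambda>h. norm (c (t + h) - c t - h *\<^sub>R c') / norm h) \<longlongrightarrow> 0) (at_right 0)"
    using assms unfolding has_vector_derivative_def has_derivative_at
    by (blast intro: tendsto_within_subset)
  moreover have "\<forall>\<^sub>F h in at_right 0. norm (c (t + h) - c t - h *\<^sub>R c') / norm h =
      norm ((c (t + h) - c t) /\<^sub>R h - c')"
    using eventually_at_right_less
  proof eventually_elim
    case (elim h)
    then have "(c (t + h) - c t) /\<^sub>R h - c' = (c (t + h) - c t - h *\<^sub>R c') /\<^sub>R h"
      by (simp add: scaleR_diff_right)
    then show ?case using elim by (simp add: divide_inverse_commute)
  qed
  ultimately have "((\<lambda>h. norm ((c (t + h) - c t) /\<^sub>R h - c')) \<longlongrightarrow> 0) (at_right 0)"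
    by (rule Lim_transform_eventually)
  then show ?thesis by (simp add: LIM_zero_iff tendsto_norm_zero_iff)
qed

lemma upper_right_dini_eq_derivative:
  assumes "(g has_real_derivative g') (at t)"
  shows "upper_right_dini g t = ereal g'"
proof -
  have "((\<lambda>h. (g (t + h) - g t) / h) \<longlongrightarrow> g') (at_right 0)"
    using has_vector_derivative_tendsto_at_right[of g g' t] assms
    by (simp add: has_real_derivative_iff_has_vector_derivative divide_inverse_commute)
  then show ?thesis
    unfolding upper_right_dini_def by (intro lim_imp_Limsup tendsto_ereal) auto
qed

lemma upper_right_dini_norm_le:
  assumes "(c has_vector_derivative c') (at t)"
  shows "upper_right_dini (\<lambda>s. norm (c s)) t \<le> ereal (norm c')"
proof -
  have "\<forall>\<^sub>F h in at_right 0.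
      ereal ((norm (c (t + h)) - norm (c t)) / h) \<le> ereal (norm ((c (t + h) - c t) /\<^sub>R h))"
    using eventually_at_right_less
    by eventually_elim (simp add: divide_inverse_commute norm_triangle_ineq2)
  then have "upper_right_dini (\<lambda>s. norm (c s)) t \<le>
      Limsup (at_right 0) (\<lambda>h. ereal (norm ((c (t + h) - c t) /\<^sub>R h)))"
    unfolding upper_right_dini_def by (rule Limsup_mono)
  also have "\<dots> = ereal (norm c')"
    by (intro lim_imp_Limsup tendsto_ereal tendsto_norm
        has_vector_derivative_tendsto_at_right[OF assms]) simp
  finally show ?thesis .
qed

lemma dini_comparison:
  fixes w z :: "real \<Rightarrow> real"
  assumes "a \<le> b" and w: "continuous_on {a..b} w" and "w a < z a"
    and z: "\<And>t. t \<in> {a..b} \<Longrightarrow> (z has_real_derivative z' t) (at t)"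
    and dini: "\<And>t. t \<in> {a<..<b} \<Longrightarrow> w t = z t \<Longrightarrow> upper_right_dini w t < ereal (z' t)"
  shows "w b \<le> z b"
proof (rule ccontr)
  assume "\<not> w b \<le> z b"
  have "continuous_on {a..b} (\<lambda>t. w t - z t)"
    using z DERIV_isCont continuous_at_imp_continuous_on w by (blast intro: continuous_intros)
  then obtain t where t: "a \<le> t" "t < b" "w t = z t"
    and after: "\<And>s. t < s \<Longrightarrow> s \<le> b \<Longrightarrow> z s < w s"
    using last_time_at_level[of a b "\<lambda>t. w t - z t" 0] \<open>a \<le> b\<close> \<open>w a < z a\<close> \<open>\<not> w b \<le> z b\<close> by auto
  have "ereal (z' t) = upper_right_dini z t"
    using upper_right_dini_eq_derivative[OF z[of t]] t by simp
  also have "\<dots> \<le> upper_right_dini w t"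
  proof (rule upper_right_dini_mono)
    have "\<forall>\<^sub>F h in at_right 0. h \<in> {0<..<b - t}"
      using t(2) by (intro eventually_at_right_real) simp
    then show "\<forall>\<^sub>F h in at_right 0. (z (t + h) - z t) / h \<le> (w (t + h) - w t) / h"
    proof eventually_elim
      case (elim h)
      then show ?case using after[of "t + h"] t(3) by (intro divide_right_mono) auto
    qed
  qed
  finally show False using dini[of t] t \<open>w a < z a\<close> by (cases "t = a") auto
qed

lemma growth_factor_0 [simp]: "growth_factor 0 L = 0"
  by (simp add: growth_factor_def)

lemma growth_factor_mult: "L * growth_factor t L = exp (L * t) - 1"
  by (simp add: growth_factor_def)

lemma growth_factor_has_derivative [derivative_intros]:
  "(g has_real_derivative g') (at t within X) \<Longrightarrow>
    ((\<lambda>t. growth_factor (g t) L) has_real_derivative exp (L * g t) * g') (at t within X)"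
  unfolding growth_factor_def by (cases "L = 0") (auto intro!: derivative_eq_intros)

lemma growth_factor_mono: "s \<le> t \<Longrightarrow> growth_factor s L \<le> growth_factor t L"
  by (rule DERIV_nonneg_imp_nondecreasing[where f = "\<lambda>t. growth_factor t L"])
    (auto intro!: exI derivative_eq_intros)

lemma growth_factor_nonneg: "0 \<le> t \<Longrightarrow> 0 \<le> growth_factor t L"
  using growth_factor_mono[of 0 t L] by simp

lemma dini_gronwall:
  fixes w :: "real \<Rightarrow> real"
  assumes "a \<le> b" and w: "continuous_on {a..b} w" and "0 \<le> w a" "0 \<le> F"
    and dini: "\<And>t. t \<in> {a<..<b} \<Longrightarrow> w t > 0 \<Longrightarrow> upper_right_dini w t \<le> ereal (L * w t + F)"
  shows "w b \<le> exp (L * (b - a)) * w a + F * growth_factor (b - a) L"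
proof (rule field_le_epsilon)
  fix e :: real assume "e > 0"
  define \<kappa> where "\<kappa> = exp (L * (b - a)) + growth_factor (b - a) L"
  have "\<kappa> > 0"
    using growth_factor_nonneg[of "b - a" L] \<open>a \<le> b\<close> by (simp add: \<kappa>_def add_pos_nonneg)
  define \<eta> where "\<eta> = e / \<kappa>"
  have \<eta>: "\<eta> > 0" using \<open>e > 0\<close> \<open>\<kappa> > 0\<close> by (simp add: \<eta>_def)
  define z where "z t = (w a + \<eta>) * exp (L * (t - a)) + (F + \<eta>) * growth_factor (t - a) L" for t
  have z_deriv: "(z has_real_derivative L * z t + (F + \<eta>)) (at t)" for t
  proof -
    have "(z has_real_derivative (w a + \<eta>) * (exp (L * (t - a)) * L) +
        (F + \<eta>) * exp (L * (t - a))) (at t)"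
      unfolding z_def by (auto intro!: derivative_eq_intros)
    moreover have "L * z t = (w a + \<eta>) * (exp (L * (t - a)) * L) +
        (F + \<eta>) * (exp (L * (t - a)) - 1)"
      unfolding z_def growth_factor_mult[symmetric] by (simp add: algebra_simps)
    ultimately show ?thesis by (simp add: algebra_simps)
  qed
  have "w b \<le> z b"
  proof (rule dini_comparison[OF \<open>a \<le> b\<close> w _ z_deriv])
    show "w a < z a" using \<eta> by (simp add: z_def)
    fix t assume t: "t \<in> {a<..<b}" and eq: "w t = z t"
    have "z t > 0"
      unfolding z_def using t \<eta> \<open>0 \<le> w a\<close> \<open>0 \<le> F\<close> growth_factor_nonneg[of "t - a" L]
      by (intro add_pos_nonneg) auto
    then show "upper_right_dini w t < ereal (L * z t + (F + \<eta>))"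
      using dini[OF t] eq \<eta> by (auto intro: le_less_trans)
  qed
  also have "z b = exp (L * (b - a)) * w a + F * growth_factor (b - a) L + \<eta> * \<kappa>"
    by (simp add: z_def \<kappa>_def algebra_simps)
  also have "\<eta> * \<kappa> = e" using \<open>\<kappa> > 0\<close> by (simp add: \<eta>_def)
  finally show "w b \<le> exp (L * (b - a)) * w a + F * growth_factor (b - a) L + e" .
qed

lemma norm_gronwall:
  fixes c :: "real \<Rightarrow> 'a::real_normed_vector"
  assumes "a \<le> b"
    and deriv: "\<And>t. t \<in> {a..b} \<Longrightarrow> (c has_vector_derivative c' t) (at t)"
    and bound: "\<And>t. t \<in> {a..b} \<Longrightarrow> norm (c' t) \<le> M * norm (c t)"
  shows "norm (c b) \<le> exp (M * (b - a)) * norm (c a)"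
proof -
  have "continuous_on {a..b} (\<lambda>t. norm (c t))"
    using deriv has_vector_derivative_at_within
    by (blast intro: continuous_on_norm continuous_on_vector_derivative)
  moreover have "upper_right_dini (\<lambda>s. norm (c s)) t \<le> ereal (M * norm (c t) + 0)"
    if "t \<in> {a<..<b}" for t
    using order_trans[OF upper_right_dini_norm_le[OF deriv, of t]] bound[of t] that by simp
  ultimately show ?thesis
    using dini_gronwall[OF \<open>a \<le> b\<close>, of "\<lambda>t. norm (c t)" 0 M] by simp
qed

lemma has_vector_derivative_compose_uminus:
  assumes "(c has_vector_derivative c') (at (- t))"
  shows "((\<lambda>s. c (- s)) has_vector_derivative - c') (at t)"
  using vector_diff_chain_at[OF has_vector_derivative_minus[OF has_vector_derivative_id] assms]
  by (simp add: o_def)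

lemma norm_gronwall_segment:
  fixes c :: "real \<Rightarrow> 'a::real_normed_vector"
  assumes deriv: "\<And>t. t \<in> closed_segment a b \<Longrightarrow> (c has_vector_derivative c' t) (at t)"
    and bound: "\<And>t. t \<in> closed_segment a b \<Longrightarrow> norm (c' t) \<le> M * norm (c t)"
  shows "norm (c b) \<le> exp (M * \<bar>b - a\<bar>) * norm (c a)"
proof (cases "a \<le> b")
  case True
  then show ?thesis
    using norm_gronwall[of a b c c' M] deriv bound by (auto simp: closed_segment_eq_real_ivl)
next
  case False
  have "((\<lambda>s. c (- s)) has_vector_derivative - c' (- s)) (at s)"
    "norm (- c' (- s)) \<le> M * norm (c (- s))" if "s \<in> {-a..-b}" for s
    using that False deriv[of "- s"] bound[of "- s"]
    by (auto simp: closed_segment_eq_real_ivl intro: has_vector_derivative_compose_uminus)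
  from norm_gronwall[of "- a" "- b" "\<lambda>s. c (- s)", OF _ this] show ?thesis
    using False by simp
qed

lemma ode_solutions_dist_le:
  fixes u v :: "real \<Rightarrow> 'a::real_normed_vector"
  assumes lip: "M-lipschitz_on K f"
    and u: "\<And>t. t \<in> closed_segment a b \<Longrightarrow> u t \<in> K \<and> (u has_vector_derivative f (u t)) (at t)"
    and v: "\<And>t. t \<in> closed_segment a b \<Longrightarrow> v t \<in> K \<and> (v has_vector_derivative f (v t)) (at t)"
  shows "dist (u b) (v b) \<le> exp (M * \<bar>b - a\<bar>) * dist (u a) (v a)"
  unfolding dist_norm
proof (rule norm_gronwall_segment)
  fix t assume t: "t \<in> closed_segment a b"
  show "((\<lambda>t. u t - v t) has_vector_derivative f (u t) - f (v t)) (at t)"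
    using u[OF t] v[OF t] by (auto intro: has_vector_derivative_diff)
  show "norm (f (u t) - f (v t)) \<le> M * norm (u t - v t)"
    using lipschitz_on_normD[OF lip] u[OF t] v[OF t] by blast
qed

section \<open>Picard iteration\<close>

lemma vector_differentiable_bound:
  fixes c :: "real \<Rightarrow> 'a::real_normed_vector"
  assumes "\<And>t. t \<in> closed_segment a b \<Longrightarrow> (c has_vector_derivative c' t) (at t within X)"
    and "closed_segment a b \<subseteq> X" and "\<And>t. t \<in> closed_segment a b \<Longrightarrow> norm (c' t) \<le> M"
  shows "norm (c b - c a) \<le> M * \<bar>b - a\<bar>"
proof -
  have "norm (c b - c a) \<le> M * norm (b - a)"
  proof (rule differentiable_bound[where S = "closed_segment a b"])
    fix t assume t: "t \<in> closed_segment a b"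
    show "(c has_derivative (\<lambda>h. h *\<^sub>R c' t)) (at t within closed_segment a b)"
      using has_vector_derivative_within_subset[OF assms(1)[OF t] assms(2)]
      by (simp add: has_vector_derivative_def)
    show "onorm (\<lambda>h. h *\<^sub>R c' t) \<le> M"
      using assms(3)[OF t] by (simp add: onorm_scaleR_left bounded_linear_ident onorm_id)
  qed auto
  then show ?thesis by simp
qed

lemma integral_compose_bcontfun_has_vector_derivative:
  fixes g :: "'a::banach \<Rightarrow> 'b::banach" and u :: "real \<Rightarrow>\<^sub>C 'a"
  assumes "continuous_on UNIV g" and "t \<in> {a..b}"
  shows "((\<lambda>t. integral {a..t} (\<lambda>s. g (u s))) has_vector_derivative g (u t)) (at t within {a..b})"
  by (rule integral_has_vector_derivative[OF _ assms(2)])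
    (auto intro: continuous_on_compose2[OF assms(1)])

lemma integral_compose_bcontfun_diff_le:
  fixes g :: "'a::banach \<Rightarrow> 'b::banach" and u v :: "real \<Rightarrow>\<^sub>C 'a"
  assumes lip: "L-lipschitz_on UNIV g" and rs: "r \<in> {a..b}" "s \<in> {a..b}"
  defines "I \<equiv> \<lambda>u t. integral {a..t} (\<lambda>s. g (apply_bcontfun u s))"
  shows "norm ((I u s - I v s) - (I u r - I v r)) \<le> L * dist u v * \<bar>s - r\<bar>"
proof (rule vector_differentiable_bound)
  show seg: "closed_segment r s \<subseteq> {a..b}" using rs by (auto simp: closed_segment_eq_real_ivl)
  fix t assume "t \<in> closed_segment r s"
  then show "((\<lambda>t. I u t - I v t) has_vector_derivative g (u t) - g (v t)) (at t within {a..b})"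
    unfolding I_def using seg lipschitz_on_continuous_on[OF lip]
    by (intro has_vector_derivative_diff integral_compose_bcontfun_has_vector_derivative) auto
  show "norm (g (u t) - g (v t)) \<le> L * dist u v"
    using lipschitz_on_normD[OF lip, of "u t" "v t"]
      mult_left_mono[OF dist_bounded lipschitz_on_nonneg[OF lip], of u t v]
    by (simp add: dist_norm)
qed

text \<open>Integrating from \<open>-h\<close> and subtracting the value at \<open>0\<close> avoids oriented integrals.\<close>

lemma picard_fixpoint:
  fixes g :: "'a::banach \<Rightarrow> 'a"
  assumes lip: "L-lipschitz_on UNIV g" and "0 < h" "h * L < 1"
  obtains u :: "real \<Rightarrow>\<^sub>C 'a" where "\<And>t. t \<in> {-h..h} \<Longrightarrow>
    u t = x + (integral {-h..t} (\<lambda>s. g (u s)) - integral {-h..0} (\<lambda>s. g (u s)))"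
proof -
  have L: "0 \<le> L" using lip by (rule lipschitz_on_nonneg)
  define I where "I u t = integral {-h..t} (\<lambda>s. g (apply_bcontfun u s))" for u t
  have I_cont: "continuous_on {-h..h} (I u)" for u
    unfolding I_def[abs_def]
    by (rule continuous_on_vector_derivative[OF
          integral_compose_bcontfun_has_vector_derivative[OF lipschitz_on_continuous_on[OF lip]]])
  have "\<exists>v. \<forall>t. apply_bcontfun v t = x + (I u (clamp (-h) h t) - I u 0)" for u
  proof (rule continuous_on_cbox_bcontfunE[of "-h" h "\<lambda>t. x + (I u t - I u 0)"])
    show "continuous_on (cbox (-h) h) (\<lambda>t. x + (I u t - I u 0))"
      using I_cont by (auto intro!: continuous_intros)
  qed blast
  then obtain T where T: "apply_bcontfun (T u) t = x + (I u (clamp (-h) h t) - I u 0)" for u t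
    by metis
  have "dist (T u) (T v) \<le> h * L * dist u v" for u v
  proof (rule dist_bound)
    fix t
    define s where "s = clamp (-h) h t"
    have s: "\<bar>s\<bar> \<le> h"
      using clamp_in_interval[of "-h" h t] \<open>0 < h\<close> by (auto simp: s_def)
    then have "norm ((I u s - I v s) - (I u 0 - I v 0)) \<le> L * dist u v * \<bar>s - 0\<bar>"
      unfolding I_def by (intro integral_compose_bcontfun_diff_le[OF lip, where b = h]) auto
    also have "\<dots> \<le> L * dist u v * h" using s L by (intro mult_left_mono) auto
    finally show "dist (T u t) (T v t) \<le> h * L * dist u v"
      by (simp add: T dist_norm s_def[symmetric] algebra_simps)
  qed
  then obtain u where "T u = u"
    using banach_fix_type[of "h * L" T] L \<open>0 < h\<close> \<open>h * L < 1\<close> by auto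
  then have "u t = x + (I u t - I u 0)" if "t \<in> {-h..h}" for t
    using T[of u t] that by simp
  then show thesis using that unfolding I_def by blast
qed

lemma picard_lindelof:
  fixes g :: "'a::banach \<Rightarrow> 'a"
  assumes lip: "L-lipschitz_on UNIV g" and "0 < h" "h * L < 1"
  obtains u where "u 0 = x" "\<And>t. t \<in> {-h<..<h} \<Longrightarrow> (u has_vector_derivative g (u t)) (at t)"
proof -
  obtain u :: "real \<Rightarrow>\<^sub>C 'a" where u: "\<And>t. t \<in> {-h..h} \<Longrightarrow>
      u t = x + (integral {-h..t} (\<lambda>s. g (u s)) - integral {-h..0} (\<lambda>s. g (u s)))"
    using picard_fixpoint assms by metis
  show thesis
  proof
    show "u 0 = x" using u[of 0] \<open>0 < h\<close> by simp
    fix t assume t: "t \<in> {-h<..<h}"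
    then have "((\<lambda>t. integral {-h..t} (\<lambda>s. g (u s))) has_vector_derivative g (u t))
        (at t within {-h..h})"
      using lipschitz_on_continuous_on[OF lip]
      by (intro integral_compose_bcontfun_has_vector_derivative) auto
    then have "((\<lambda>t. integral {-h..t} (\<lambda>s. g (u s))) has_vector_derivative g (u t))
        (at t within {-h<..<h})"
      by (rule has_vector_derivative_within_subset) auto
    then have "((\<lambda>t. integral {-h..t} (\<lambda>s. g (u s))) has_vector_derivative g (u t)) (at t)"
      using at_within_open[OF t] by simp
    from has_vector_derivative_add[OF has_vector_derivative_const
        has_vector_derivative_diff[OF this has_vector_derivative_const]]
    have "((\<lambda>t. x + (integral {-h..t} (\<lambda>s. g (u s)) - integral {-h..0} (\<lambda>s. g (u s))))
        has_vector_derivative g (u t)) (at t)"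
      by simp
    then show "(u has_vector_derivative g (u t)) (at t)"
      by (rule has_vector_derivative_transform_within_open[of _ _ _ "{-h<..<h}"])
        (use t u in auto)
  qed
qed

lemma picard_lindelof_cball:
  fixes g :: "'a::euclidean_space \<Rightarrow> 'a"
  assumes lip: "L-lipschitz_on (cball x r) g" and M: "\<And>y. y \<in> cball x r \<Longrightarrow> norm (g y) \<le> M"
    and "0 \<le> r" "0 < h" "h * L < 1" "h * M \<le> r"
  obtains u where "u 0 = x"
    "\<And>t. t \<in> {-h<..<h} \<Longrightarrow> u t \<in> cball x r \<and> (u has_vector_derivative g (u t)) (at t)"
proof -
  define p where "p = closest_point (cball x r)"
  have p: "p y \<in> cball x r" for y
    using \<open>0 \<le> r\<close> unfolding p_def by (intro closest_point_in_set) auto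
  have "1-lipschitz_on UNIV p"
    using \<open>0 \<le> r\<close> unfolding p_def by (intro lipschitz_onI) (auto intro: closest_point_lipschitz)
  moreover have "L-lipschitz_on (range p) g"
    using p by (blast intro: lipschitz_on_subset[OF lip])
  ultimately have "L-lipschitz_on UNIV (g \<circ> p)"
    using lipschitz_on_compose by fastforce
  then obtain u where u: "u 0 = x"
    "\<And>t. t \<in> {-h<..<h} \<Longrightarrow> (u has_vector_derivative (g \<circ> p) (u t)) (at t)"
    using picard_lindelof \<open>0 < h\<close> \<open>h * L < 1\<close> by metis
  have u_cball: "u t \<in> cball x r" if t: "t \<in> {-h<..<h}" for t
  proof -
    have "closed_segment 0 t \<subseteq> {-h<..<h}"
      using t \<open>0 < h\<close> by (intro closed_segment_subset) auto
    then have "norm (u t - u 0) \<le> M * \<bar>t - 0\<bar>"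
      using u(2) M p
      by (intro vector_differentiable_bound[where X = UNIV and c' = "\<lambda>s. (g \<circ> p) (u s)"]) auto
    also have "\<dots> \<le> M * h"
      using t order_trans[OF norm_ge_zero M[OF p]] by (intro mult_left_mono) auto
    finally show ?thesis
      using u(1) \<open>h * M \<le> r\<close> by (simp add: dist_norm norm_minus_commute mult.commute)
  qed
  then have "(u has_vector_derivative g (u t)) (at t)" if "t \<in> {-h<..<h}" for t
    using u(2)[OF that] closest_point_self[OF u_cball[OF that]] by (simp add: p_def)
  then show thesis using that[of u] u(1) u_cball by blast
qed

section \<open>The flow of a locally Lipschitz vector field\<close>

lemma ivp_solution_continuous_on:
  assumes "ivp_solution D f x J u" "X \<subseteq> J"
  shows "continuous_on X u"
  using assms unfolding ivp_solution_def
  by (meson continuous_at_imp_continuous_on has_vector_derivative_continuous subset_iff)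

lemma ivp_solution_shift:
  assumes u: "ivp_solution D f x J u" and "s \<in> J"
  shows "ivp_solution D f (u s) {t. t + s \<in> J} (\<lambda>t. u (t + s))"
  unfolding ivp_solution_def
proof (intro conjI ballI)
  have J: "open J" "is_interval J" using u by (auto simp: ivp_solution_def)
  have "open ((\<lambda>t. t + s) -` J)" by (intro open_vimage J continuous_intros)
  then show "open {t. t + s \<in> J}" by (simp add: vimage_def)
  show "is_interval {t. t + s \<in> J}"
    using J(2) unfolding is_interval_1 by (smt (verit) mem_Collect_eq)
  fix t assume "t \<in> {t. t + s \<in> J}"
  then have in_D: "u (t + s) \<in> D"
    and deriv: "(u has_vector_derivative f (u (t + s))) (at (t + s))"
    using u by (auto simp: ivp_solution_def)
  show "u (t + s) \<in> D" by (rule in_D)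
  show "((\<lambda>t. u (t + s)) has_vector_derivative f (u (t + s))) (at t)"
    using vector_diff_chain_at[OF has_vector_derivative_add[OF has_vector_derivative_id
          has_vector_derivative_const] deriv]
    by (simp add: o_def)
qed (use assms in auto)

lemma ivp_solution_existence_intervalI:
  assumes agree: "\<And>J u t. ivp_solution D f x J u \<Longrightarrow> t \<in> J \<Longrightarrow> w t = u t"
    and nonempty: "existence_interval D f x \<noteq> {}"
  shows "ivp_solution D f x (existence_interval D f x) w"
  unfolding ivp_solution_def
proof (intro conjI ballI)
  let ?I = "existence_interval D f x"
  show "open ?I"
    unfolding existence_interval_def by (rule open_Union) (auto simp: ivp_solution_def)
  show "is_interval ?I"
    unfolding existence_interval_def is_interval_connected_1
    by (rule connected_Union) (auto simp: ivp_solution_def is_interval_connected_1)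
  obtain J u where "ivp_solution D f x J u"
    using nonempty by (auto simp: existence_interval_def)
  then show "0 \<in> ?I" "w 0 = x"
    using agree[of J u 0] by (auto simp: ivp_solution_def existence_interval_def)
  fix t assume "t \<in> ?I"
  then obtain J u where Ju: "ivp_solution D f x J u" "t \<in> J"
    by (auto simp: existence_interval_def)
  then have u: "(u has_vector_derivative f (u t)) (at t)" "open J" "u t \<in> D"
    by (auto simp: ivp_solution_def)
  have "(w has_vector_derivative f (u t)) (at t)"
    using has_vector_derivative_transform_within_open[OF u(1,2) Ju(2)] agree[OF Ju(1)] by simp
  with u show "w t \<in> D" "(w has_vector_derivative f (w t)) (at t)"
    by (simp_all add: agree[OF Ju])
qed

locale lipschitz_ode =
  fixes D :: "(real ^ 'd) set" and f :: "real ^ 'd \<Rightarrow> real ^ 'd"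
  assumes open_D: "open D"
    and lipschitz_compact: "\<And>K. compact K \<Longrightarrow> K \<subseteq> D \<Longrightarrow> \<exists>M. M-lipschitz_on K f"
begin

abbreviation existence_times ("\<I>") where "\<I> x \<equiv> existence_interval D f x"

abbreviation solution_flow ("\<phi>") where "\<phi> t x \<equiv> flow D f t x"

lemma continuous_on_vector_field: "compact K \<Longrightarrow> K \<subseteq> D \<Longrightarrow> continuous_on K f"
  using lipschitz_compact lipschitz_on_continuous_on by blast

lemma ivp_solution_unique:
  assumes u: "ivp_solution D f x J u" and v: "ivp_solution D f y J' v"
    and "a \<in> J \<inter> J'" "b \<in> J \<inter> J'" "u a = v a"
  shows "u b = v b"
proof -
  define C where "C = closed_segment a b"
  have C: "C \<subseteq> J" "C \<subseteq> J'"
    using u v assms(3,4) unfolding C_def ivp_solution_def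
    by (auto simp: is_interval_convex closed_segment_subset)
  then have "continuous_on C u" "continuous_on C v"
    using u v by (auto intro: ivp_solution_continuous_on)
  then have "compact (u ` C \<union> v ` C)"
    unfolding C_def by (intro compact_Un compact_continuous_image) auto
  moreover have "u ` C \<union> v ` C \<subseteq> D"
    using u v C unfolding ivp_solution_def by blast
  ultimately obtain M where M: "M-lipschitz_on (u ` C \<union> v ` C) f"
    using lipschitz_compact by blast
  have "dist (u b) (v b) \<le> exp (M * \<bar>b - a\<bar>) * dist (u a) (v a)"
    by (rule ode_solutions_dist_le[OF M]; fold C_def)
      (use u v C in \<open>auto simp: ivp_solution_def\<close>)
  then show ?thesis using \<open>u a = v a\<close> by simp
qed

lemma maximal_ivp_solution_exists:
  assumes "\<I> x \<noteq> {}"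
  shows "\<exists>u. ivp_solution D f x (\<I> x) u"
proof -
  define w where "w t = (SOME y. \<exists>J u. ivp_solution D f x J u \<and> t \<in> J \<and> y = u t)" for t
  have "w t = u t" if Ju: "ivp_solution D f x J u" "t \<in> J" for J u t
  proof -
    have "\<exists>J' u'. ivp_solution D f x J' u' \<and> t \<in> J' \<and> w t = u' t"
      unfolding w_def by (rule someI_ex) (use Ju in blast)
    then obtain J' u' where "ivp_solution D f x J' u'" "t \<in> J'" "w t = u' t" by blast
    then show ?thesis
      using ivp_solution_unique[of x J' u' x J u 0 t] Ju by (auto simp: ivp_solution_def)
  qed
  then show ?thesis using ivp_solution_existence_intervalI assms by blast
qed

lemma compact_lipschitz_neighbourhood:
  assumes "compact C" "C \<subseteq> D"
  obtains r L where "r > 0" "compact (\<Union>x\<in>C. cball x r)" "(\<Union>x\<in>C. cball x r) \<subseteq> D"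
    "L-lipschitz_on (\<Union>x\<in>C. cball x r) f"
  using compact_subset_open_imp_cball_epsilon_subset[OF assms(1) open_D assms(2)]
    compact_minkowski_sum_cball[OF assms(1)] lipschitz_compact by metis

lemma local_existence_uniform:
  assumes "compact C" "C \<subseteq> D"
  obtains h where "h > 0" "\<And>x. x \<in> C \<Longrightarrow> {-h<..<h} \<subseteq> \<I> x"
proof -
  obtain r L where r: "r > 0" and K: "compact (\<Union>x\<in>C. cball x r)" "(\<Union>x\<in>C. cball x r) \<subseteq> D"
    and L: "L-lipschitz_on (\<Union>x\<in>C. cball x r) f"
    using compact_lipschitz_neighbourhood[OF assms] by metis
  have "bounded (f ` (\<Union>x\<in>C. cball x r))"
    using K by (intro compact_imp_bounded compact_continuous_image continuous_on_vector_field)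
  then obtain M where M: "M > 0" "\<And>y. y \<in> (\<Union>x\<in>C. cball x r) \<Longrightarrow> norm (f y) \<le> M"
    unfolding bounded_pos by blast
  have "0 \<le> L" using L by (rule lipschitz_on_nonneg)
  define h where "h = min (r / M) (1 / (L + 1))"
  have "h > 0" using M(1) r \<open>0 \<le> L\<close> by (simp add: h_def)
  have "h * M \<le> r" using M(1) by (simp add: h_def min_def field_simps)
  have "h \<le> 1 / (L + 1)" by (simp add: h_def)
  then have "h * (L + 1) \<le> 1" using \<open>0 \<le> L\<close> by (simp add: pos_le_divide_eq)
  then have "h * L < 1" using \<open>h > 0\<close> by (simp add: distrib_left)
  have "{-h<..<h} \<subseteq> \<I> x" if "x \<in> C" for x
  proof -
    have cball: "cball x r \<subseteq> (\<Union>x\<in>C. cball x r)" using that by blast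
    obtain u where u: "u 0 = x"
      "\<And>t. t \<in> {-h<..<h} \<Longrightarrow> u t \<in> cball x r \<and> (u has_vector_derivative f (u t)) (at t)"
    proof (rule picard_lindelof_cball[OF lipschitz_on_subset[OF L cball]])
      show "norm (f y) \<le> M" if "y \<in> cball x r" for y using M(2) cball that by blast
    qed (use r \<open>h > 0\<close> \<open>h * L < 1\<close> \<open>h * M \<le> r\<close> in auto)
    moreover have "cball x r \<subseteq> D" using cball K(2) by (rule subset_trans)
    ultimately have "ivp_solution D f x {-h<..<h} u"
      using \<open>h > 0\<close> unfolding ivp_solution_def by (auto simp: is_interval_1 subset_iff)
    then show ?thesis unfolding existence_interval_def by blast
  qed
  with \<open>h > 0\<close> show thesis by (rule that)
qed

lemma ivp_solution_flow:
  assumes "x \<in> D"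
  shows "ivp_solution D f x (\<I> x) (\<lambda>t. \<phi> t x)"
proof -
  obtain h where "h > 0" "{-h<..<h} \<subseteq> \<I> x"
    using local_existence_uniform[of "{x}"] assms by auto
  then have "0 \<in> \<I> x" by auto
  then have "\<exists>u. ivp_solution D f x (\<I> x) u"
    by (intro maximal_ivp_solution_exists) auto
  from someI_ex[OF this] show ?thesis by (simp add: flow_def)
qed

lemma open_existence_interval: "x \<in> D \<Longrightarrow> open (\<I> x)"
  and is_interval_existence_interval: "x \<in> D \<Longrightarrow> is_interval (\<I> x)"
  and zero_in_existence_interval: "x \<in> D \<Longrightarrow> 0 \<in> \<I> x"
  and flow_0: "x \<in> D \<Longrightarrow> \<phi> 0 x = x"
  and flow_in_domain: "x \<in> D \<Longrightarrow> t \<in> \<I> x \<Longrightarrow> \<phi> t x \<in> D"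
  and flow_has_vector_derivative:
    "x \<in> D \<Longrightarrow> t \<in> \<I> x \<Longrightarrow> ((\<lambda>t. \<phi> t x) has_vector_derivative f (\<phi> t x)) (at t)"
  using ivp_solution_flow by (auto simp: ivp_solution_def)

lemma atLeastAtMost_subset_existence_interval:
  "x \<in> D \<Longrightarrow> t \<in> \<I> x \<Longrightarrow> {0..t} \<subseteq> \<I> x"
  using is_interval_existence_interval zero_in_existence_interval unfolding is_interval_1
  by (meson atLeastAtMost_iff subsetI)

lemma continuous_on_flow_time:
  "x \<in> D \<Longrightarrow> X \<subseteq> \<I> x \<Longrightarrow> continuous_on X (\<lambda>t. \<phi> t x)"
  using ivp_solution_continuous_on[OF ivp_solution_flow] .

lemma ivp_solution_imp_flow:
  assumes u: "ivp_solution D f x J u" and "t \<in> J"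
  shows "t \<in> \<I> x" "\<phi> t x = u t"
proof -
  show t: "t \<in> \<I> x" using assms by (auto simp: existence_interval_def)
  have "x \<in> D" "0 \<in> J" "u 0 = x" using u by (auto simp: ivp_solution_def)
  then show "\<phi> t x = u t"
    using ivp_solution_unique[OF ivp_solution_flow u, where a = 0 and b = t] t \<open>t \<in> J\<close>
      zero_in_existence_interval flow_0 by simp
qed

lemma flow_add:
  assumes x: "x \<in> D" and t: "t \<in> \<I> x" and s: "s \<in> \<I> (\<phi> t x)"
  shows "t + s \<in> \<I> x" "\<phi> (t + s) x = \<phi> s (\<phi> t x)"
proof -
  have "- t \<in> \<I> (\<phi> t x)" and backward: "\<phi> (- t) (\<phi> t x) = x"
    using ivp_solution_imp_flow[OF ivp_solution_shift[OF ivp_solution_flow[OF x] t], of "- t"]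
      zero_in_existence_interval[OF x] flow_0[OF x] by auto
  then have "ivp_solution D f x {r. r + - t \<in> \<I> (\<phi> t x)} (\<lambda>r. \<phi> (r + - t) (\<phi> t x))"
    using ivp_solution_shift[OF ivp_solution_flow[OF flow_in_domain[OF x t]], of "- t"] by simp
  from ivp_solution_imp_flow[OF this, of "t + s"] s
  show "t + s \<in> \<I> x" "\<phi> (t + s) x = \<phi> s (\<phi> t x)" by auto
qed

lemma forward_complete_flow:
  assumes x: "x \<in> D" "{0..} \<subseteq> \<I> x" and "0 \<le> t"
  shows "{0..} \<subseteq> \<I> (\<phi> t x)"
proof
  fix s :: real assume "s \<in> {0..}"
  then have "s + t \<in> \<I> x" "t \<in> \<I> x" using x(2) \<open>0 \<le> t\<close> by auto
  then show "s \<in> \<I> (\<phi> t x)"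
    using ivp_solution_imp_flow[OF ivp_solution_shift[OF ivp_solution_flow[OF x(1)]], of t s]
    by auto
qed

lemma flow_add_nonneg:
  assumes "x \<in> D" "{0..} \<subseteq> \<I> x" "0 \<le> t" "0 \<le> s"
  shows "\<phi> (t + s) x = \<phi> s (\<phi> t x)"
  using flow_add(2)[of x t s] forward_complete_flow[of x t] assms by auto

lemma flow_dist_le:
  assumes lip: "M-lipschitz_on K f" and "0 \<le> t"
    and x: "x \<in> D" "{0..t} \<subseteq> \<I> x" and y: "y \<in> D" "{0..t} \<subseteq> \<I> y"
    and K: "\<And>s. s \<in> {0..t} \<Longrightarrow> \<phi> s x \<in> K \<and> \<phi> s y \<in> K"
  shows "dist (\<phi> t y) (\<phi> t x) \<le> exp (M * t) * dist y x"
proof -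
  have "dist (\<phi> t y) (\<phi> t x) \<le> exp (M * \<bar>t - 0\<bar>) * dist (\<phi> 0 y) (\<phi> 0 x)"
    by (rule ode_solutions_dist_le[OF lip])
      (use x y K flow_has_vector_derivative \<open>0 \<le> t\<close> in \<open>auto simp: closed_segment_eq_real_ivl\<close>)
  then show ?thesis using x(1) y(1) \<open>0 \<le> t\<close> by (simp add: flow_0)
qed

lemma flow_dist_le_near_orbit:
  assumes lip: "M-lipschitz_on (\<Union>s\<in>{0..b}. cball (\<phi> s x) r) f"
    and x: "x \<in> D" "{0..b} \<subseteq> \<I> x" and y: "y \<in> D" "{0..b} \<subseteq> \<I> y"
    and small: "exp (M * b) * dist y x < r" and t: "t \<in> {0..b}"
  shows "dist (\<phi> t y) (\<phi> t x) \<le> exp (M * b) * dist y x"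
proof -
  define d where "d t = dist (\<phi> t y) (\<phi> t x)" for t
  have "0 \<le> M" using lip by (rule lipschitz_on_nonneg)
  have exp_le: "exp (M * t) * dist y x \<le> exp (M * b) * dist y x" if "t \<in> {0..b}" for t
    using that \<open>0 \<le> M\<close> by (intro mult_right_mono) (auto intro: mult_left_mono)
  have "0 < r" using small by (rule le_less_trans[rotated]) simp
  have gronwall: "d t \<le> exp (M * b) * dist y x"
    if t: "t \<in> {0..b}" and near: "\<And>s. s \<in> {0..t} \<Longrightarrow> d s \<le> r" for t
  proof -
    have "d t \<le> exp (M * t) * dist y x"
      unfolding d_def
    proof (rule flow_dist_le[OF lip])
      fix s assume s: "s \<in> {0..t}"
      then have "s \<in> {0..b}" using t by simp
      moreover have "\<phi> s x \<in> cball (\<phi> s x) r" "\<phi> s y \<in> cball (\<phi> s x) r"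
        using near[OF s] \<open>0 < r\<close> by (simp_all add: d_def dist_commute)
      ultimately show "\<phi> s x \<in> (\<Union>s\<in>{0..b}. cball (\<phi> s x) r) \<and>
          \<phi> s y \<in> (\<Union>s\<in>{0..b}. cball (\<phi> s x) r)"
        by blast
    qed (use t x y in auto)
    also note exp_le[OF t]
    finally show ?thesis .
  qed
  have near: "d s < r" if "s \<in> {0..b}" for s
  proof (rule continuity_bootstrap[OF _ _ _ that])
    show "continuous_on {0..b} d"
      unfolding d_def by (intro continuous_intros continuous_on_flow_time x y)
    show "d 0 < r"
      using exp_le[of 0] small t x(1) y(1) by (simp add: d_def flow_0)
    show "d u < r" if "u \<in> {0..b}" "\<And>v. v \<in> {0..u} \<Longrightarrow> d v \<le> r" for u
      using gronwall[OF that] small by linarith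
  qed
  have "d t \<le> exp (M * b) * dist y x"
    using t by (intro gronwall less_imp_le[OF near]) auto
  then show ?thesis by (simp add: d_def)
qed

lemma flow_dependence:
  assumes x: "x \<in> D" and xb: "{0..b} \<subseteq> \<I> x"
  obtains \<delta> M where "\<delta> > 0"
    "\<And>y t. y \<in> D \<Longrightarrow> dist y x < \<delta> \<Longrightarrow> {0..b} \<subseteq> \<I> y \<Longrightarrow> t \<in> {0..b} \<Longrightarrow>
      dist (\<phi> t y) (\<phi> t x) \<le> M * dist y x"
proof -
  have "compact ((\<lambda>t. \<phi> t x) ` {0..b})"
    by (intro compact_continuous_image continuous_on_flow_time x xb) auto
  moreover have "(\<lambda>t. \<phi> t x) ` {0..b} \<subseteq> D" using flow_in_domain[OF x] xb by auto
  ultimately obtain r M where r: "r > 0"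
    and M: "M-lipschitz_on (\<Union>z\<in>(\<lambda>t. \<phi> t x) ` {0..b}. cball z r) f"
    using compact_lipschitz_neighbourhood by metis
  have lip: "M-lipschitz_on (\<Union>s\<in>{0..b}. cball (\<phi> s x) r) f" using M by simp
  show thesis
  proof (rule that)
    show "r / exp (M * b) > 0" using r by simp
    fix y t assume y: "y \<in> D" "{0..b} \<subseteq> \<I> y" and t: "t \<in> {0..b}"
      and "dist y x < r / exp (M * b)"
    then have "exp (M * b) * dist y x < r" by (simp add: field_simps)
    then show "dist (\<phi> t y) (\<phi> t x) \<le> exp (M * b) * dist y x"
      using t by (intro flow_dist_le_near_orbit[OF lip x xb y])
  qed
qed

lemma continuous_on_flow:
  assumes "A \<subseteq> D" "0 \<le> b" and ex: "\<And>x. x \<in> A \<Longrightarrow> {0..b} \<subseteq> \<I> x"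
  shows "continuous_on ({0..b} \<times> A) (\<lambda>(t, x). \<phi> t x)"
  unfolding continuous_on_sequentially
proof (intro allI ballI impI, elim conjE)
  fix p and q :: "real \<times> (real ^ 'd)"
  assume q: "q \<in> {0..b} \<times> A" and "\<forall>n. p n \<in> {0..b} \<times> A" and lim: "p \<longlonglongrightarrow> q"
  define t z where "t n = fst (p n)" and "z n = snd (p n)" for n
  have p: "t n \<in> {0..b}" "z n \<in> A" for n
    using \<open>\<forall>n. p n \<in> {0..b} \<times> A\<close> by (auto simp: t_def z_def mem_Times_iff)
  obtain s x where sx: "q = (s, x)" by (cases q)
  have x: "x \<in> A" "s \<in> {0..b}" using q sx by auto
  have t: "t \<longlonglongrightarrow> s" and z: "z \<longlonglongrightarrow> x"
    using tendsto_fst[OF lim] tendsto_snd[OF lim]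
    by (simp_all add: sx t_def[abs_def] z_def[abs_def])
  obtain \<delta> M where "\<delta> > 0" and dep: "\<And>y t. y \<in> D \<Longrightarrow> dist y x < \<delta> \<Longrightarrow>
      {0..b} \<subseteq> \<I> y \<Longrightarrow> t \<in> {0..b} \<Longrightarrow> dist (\<phi> t y) (\<phi> t x) \<le> M * dist y x"
    using flow_dependence[of x b] assms x by (metis subsetD)
  have "(\<lambda>n. \<phi> (t n) (z n) - \<phi> (t n) x) \<longlonglongrightarrow> 0"
  proof (rule Lim_null_comparison)
    show "\<forall>\<^sub>F n in sequentially. norm (\<phi> (t n) (z n) - \<phi> (t n) x) \<le> M * dist (z n) x"
      using tendstoD[OF z \<open>\<delta> > 0\<close>]
    proof eventually_elim
      case (elim n)
      then show ?case using dep[of "z n" "t n"] p[of n] assms(1) ex by (auto simp: dist_norm)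
    qed
    show "(\<lambda>n. M * dist (z n) x) \<longlonglongrightarrow> 0"
      by (rule tendsto_mult_right_zero[OF iffD1[OF tendsto_dist_iff z]])
  qed
  moreover have "(\<lambda>n. \<phi> (t n) x) \<longlonglongrightarrow> \<phi> s x"
  proof (rule continuous_on_tendsto_compose[OF _ t x(2)])
    show "continuous_on {0..b} (\<lambda>t. \<phi> t x)"
      using x(1) assms(1) ex by (intro continuous_on_flow_time) auto
  qed (intro always_eventually allI p)
  ultimately have "(\<lambda>n. \<phi> (t n) (z n)) \<longlonglongrightarrow> \<phi> s x"
    by (rule Lim_transform[rotated])
  then show "((\<lambda>(t, x). \<phi> t x) \<circ> p) \<longlonglongrightarrow> (case q of (t, x) \<Rightarrow> \<phi> t x)"
    by (simp add: o_def sx case_prod_beta t_def z_def)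
qed

lemma continuous_on_flow_state:
  assumes "A \<subseteq> D" "0 \<le> s" and "\<And>x. x \<in> A \<Longrightarrow> {0..s} \<subseteq> \<I> x"
  shows "continuous_on A (\<phi> s)"
proof -
  have "continuous_on A (\<lambda>x. (\<lambda>(t, x). \<phi> t x) (s, x))"
    by (rule continuous_on_compose2[OF continuous_on_flow[OF assms]])
      (use \<open>0 \<le> s\<close> in \<open>auto intro!: continuous_intros\<close>)
  then show ?thesis by simp
qed

lemma reachable_tube_subset: "A \<subseteq> D \<Longrightarrow> reachable_tube D f \<tau> A \<subseteq> D"
  using flow_in_domain unfolding reachable_tube_def by blast

lemma subset_reachable_tube:
  assumes "A \<subseteq> D" "0 \<le> \<tau>"
  shows "A \<subseteq> reachable_tube D f \<tau> A"
proof
  fix x assume "x \<in> A"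
  then have "x = \<phi> 0 x \<and> x \<in> A \<and> 0 \<in> {0..\<tau>} \<inter> \<I> x"
    using assms flow_0[of x] zero_in_existence_interval[of x] by auto
  then show "x \<in> reachable_tube D f \<tau> A" unfolding reachable_tube_def by blast
qed

lemma compact_reachable_tube:
  assumes A: "compact A" "A \<subseteq> D" and "0 \<le> \<tau>" and ex: "\<And>x. x \<in> A \<Longrightarrow> {0..\<tau>} \<subseteq> \<I> x"
  shows "compact (reachable_tube D f \<tau> A)"
proof -
  have "reachable_tube D f \<tau> A = (\<lambda>(t, x). \<phi> t x) ` ({0..\<tau>} \<times> A)"
    using ex unfolding reachable_tube_def by (fastforce simp: image_def)
  then show ?thesis
    using continuous_on_flow[OF A(2) \<open>0 \<le> \<tau>\<close> ex] A(1)
    by (auto intro!: compact_continuous_image compact_Times)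
qed

section \<open>Limit sets and recurrent sets\<close>

definition omega_limit_set :: "real ^ 'd \<Rightarrow> (real ^ 'd) set" where
  "omega_limit_set x = (\<Inter>T\<in>{0..}. closure ((\<lambda>t. \<phi> t x) ` {T..}))"

lemma closed_omega_limit_set: "closed (omega_limit_set x)"
  unfolding omega_limit_set_def by (intro closed_INT) auto

lemma omega_limit_set_Int_compact_nonempty:
  assumes "compact S" and visits: "\<And>T. \<exists>t\<ge>T. \<phi> t x \<in> S"
  shows "S \<inter> omega_limit_set x \<noteq> {}"
  unfolding omega_limit_set_def
proof (rule compact_imp_fip_image[OF \<open>compact S\<close>])
  fix R :: "real set" assume R: "finite R"
  obtain t where t: "Max (insert 0 R) \<le> t" "\<phi> t x \<in> S" using visits by blast
  then have "\<phi> t x \<in> closure ((\<lambda>t. \<phi> t x) ` {T..})" if "T \<in> R" for T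
    using R that by (intro closure_subset[THEN subsetD] imageI) simp
  then show "S \<inter> (\<Inter>T\<in>R. closure ((\<lambda>t. \<phi> t x) ` {T..})) \<noteq> {}" using t(2) by blast
qed simp

lemma omega_limit_set_visits_open:
  assumes "p \<in> omega_limit_set x" "open U" "p \<in> U"
  obtains t where "0 \<le> t" "\<phi> t x \<in> U"
proof -
  have "p \<in> closure ((\<lambda>t. \<phi> t x) ` {0..})" using assms(1) by (auto simp: omega_limit_set_def)
  then have "(\<lambda>t. \<phi> t x) ` {0..} \<inter> U \<noteq> {}"
    using open_Int_closure_eq_empty[OF \<open>open U\<close>] \<open>p \<in> U\<close> by blast
  then show thesis using that by auto
qed

lemma flow_omega_limit_set:
  assumes x: "x \<in> D" "{0..} \<subseteq> \<I> x" and p: "p \<in> omega_limit_set x" "p \<in> D"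
    and s: "0 \<le> s" "s \<in> \<I> p"
  shows "\<phi> s p \<in> omega_limit_set x"
  unfolding omega_limit_set_def
proof (rule INT_I)
  fix T :: real assume "T \<in> {0..}"
  define B where "B = (\<lambda>t. \<phi> t x) ` {T..}"
  have "y \<in> D \<and> {0..s} \<subseteq> \<I> y" if y: "y \<in> B" for y
  proof -
    obtain t where t: "T \<le> t" "y = \<phi> t x" using y by (auto simp: B_def)
    then have "0 \<le> t" using \<open>T \<in> {0..}\<close> by simp
    then show ?thesis
      using flow_in_domain[OF x(1), of t] forward_complete_flow[OF x, of t] x(2) t(2) by auto
  qed
  then have cont: "continuous_on (insert p B) (\<phi> s)"
    using p(2) atLeastAtMost_subset_existence_interval[OF p(2) s(2)] s(1)
    by (intro continuous_on_flow_state) auto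
  have shift: "\<phi> s ` B \<subseteq> B"
  proof (unfold B_def, safe)
    fix t assume "T \<le> t"
    then have "\<phi> s (\<phi> t x) = \<phi> (t + s) x" "T \<le> t + s"
      using flow_add_nonneg[OF x, of t s] s(1) \<open>T \<in> {0..}\<close> by auto
    then show "\<phi> s (\<phi> t x) \<in> (\<lambda>t. \<phi> t x) ` {T..}" by simp
  qed
  have "p \<in> closure B" using p(1) \<open>T \<in> {0..}\<close> by (auto simp: omega_limit_set_def B_def)
  then obtain y where y: "\<And>n. y n \<in> B" "y \<longlonglongrightarrow> p" unfolding closure_sequential by metis
  have "(\<lambda>n. \<phi> s (y n)) \<longlonglongrightarrow> \<phi> s p"
    using cont y(2) by (rule continuous_on_tendsto_compose) (auto simp: y(1))
  moreover have "\<phi> s (y n) \<in> B" for n using shift y(1) by blast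
  ultimately show "\<phi> s p \<in> closure B"
    unfolding closure_sequential by (intro exI[of _ "\<lambda>n. \<phi> s (y n)"]) simp
qed

lemma omega_limit_set_minimum:
  assumes x: "x \<in> D" "{0..} \<subseteq> \<I> x" and S: "compact S" "S \<subseteq> D" "S \<inter> omega_limit_set x \<noteq> {}"
    and V: "continuous_on S V"
  obtains p where "p \<in> S" "p \<in> omega_limit_set x"
    "\<And>s. 0 \<le> s \<Longrightarrow> s \<in> \<I> p \<Longrightarrow> \<phi> s p \<in> S \<Longrightarrow> (V p :: real) \<le> V (\<phi> s p)"
proof -
  have "compact (S \<inter> omega_limit_set x)" "continuous_on (S \<inter> omega_limit_set x) V"
    using S(1) closed_omega_limit_set continuous_on_subset[OF V] by auto
  then obtain p where p: "p \<in> S \<inter> omega_limit_set x"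
    and min: "\<And>y. y \<in> S \<inter> omega_limit_set x \<Longrightarrow> V p \<le> V y"
    using continuous_attains_inf[of "S \<inter> omega_limit_set x" V] S(3) by blast
  then show thesis using that[of p] flow_omega_limit_set[OF x] S(2) by blast
qed

definition visit_times :: "(real ^ 'd) set \<Rightarrow> real ^ 'd \<Rightarrow> real set" where
  "visit_times S x = {t \<in> {0..} \<inter> \<I> x. \<phi> t x \<in> S}"

definition recurrent :: "(real ^ 'd) set \<Rightarrow> bool" where
  "recurrent S \<longleftrightarrow> (\<forall>x\<in>S. \<exists>t>0. t \<in> visit_times S x)"

lemma closed_visit_times:
  assumes S: "compact S" "S \<subseteq> D" and x: "x \<in> D"
  shows "closed (visit_times S x)"
  unfolding closed_sequential_limits
proof safe
  fix a T assume "\<forall>n. a n \<in> visit_times S x" and lim: "a \<longlonglongrightarrow> T"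
  then have a: "0 \<le> a n" "a n \<in> \<I> x" "\<phi> (a n) x \<in> S" for n by (auto simp: visit_times_def)
  obtain h where h: "h > 0" "\<And>y. y \<in> S \<Longrightarrow> {-h<..<h} \<subseteq> \<I> y"
    using local_existence_uniform[OF S] by blast
  obtain n where "dist (a n) T < h"
    using tendstoD[OF lim h(1)] eventually_happens by fastforce
  then have "T - a n \<in> {-h<..<h}" by (auto simp: dist_real_def)
  then have "T - a n \<in> \<I> (\<phi> (a n) x)" using h(2)[OF a(3)] by blast
  then have T: "T \<in> \<I> x" using flow_add(1)[OF x a(2)[of n], of "T - a n"] by simp
  have "(\<lambda>n. \<phi> (a n) x) \<longlonglongrightarrow> \<phi> T x"
    by (rule continuous_on_tendsto_compose[OF continuous_on_flow_time[OF x order_refl] lim T])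
      (simp add: a)
  with compact_imp_closed[OF S(1)] a(3) have "\<phi> T x \<in> S" by (rule closed_sequentially)
  moreover have "0 \<le> T" using LIMSEQ_le_const[OF lim] a(1) by blast
  ultimately show "T \<in> visit_times S x" using T by (simp add: visit_times_def)
qed

lemma visit_times_interior:
  assumes "S \<subseteq> D" and x: "x \<in> interior S"
  obtains t where "t > 0" "t \<in> visit_times S x"
proof -
  have xD: "x \<in> D" using x assms(1) interior_subset by blast
  have "open (\<I> x \<inter> (\<lambda>t. \<phi> t x) -` interior S)"
    by (intro continuous_open_preimage continuous_on_flow_time open_existence_interval xD) auto
  moreover have "0 \<in> \<I> x \<inter> (\<lambda>t. \<phi> t x) -` interior S"
    using x xD by (simp add: zero_in_existence_interval flow_0)
  ultimately obtain e where e: "e > 0" "ball 0 e \<subseteq> \<I> x \<inter> (\<lambda>t. \<phi> t x) -` interior S"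
    using open_contains_ball by metis
  moreover have "e / 2 \<in> ball 0 e" using e(1) by (simp add: dist_norm)
  ultimately have "e / 2 \<in> \<I> x \<inter> (\<lambda>t. \<phi> t x) -` interior S" by blast
  then show thesis
    using that[of "e / 2"] e(1) interior_subset[of S] by (auto simp: visit_times_def)
qed

lemma not_bdd_above_visit_times:
  assumes S: "compact S" "S \<subseteq> D" "recurrent S" and x: "x \<in> S"
  shows "\<not> bdd_above (visit_times S x)"
proof
  assume bdd: "bdd_above (visit_times S x)"
  define T where "T = Sup (visit_times S x)"
  have xD: "x \<in> D" using x S(2) by blast
  then have "0 \<in> visit_times S x"
    using x by (simp add: visit_times_def zero_in_existence_interval flow_0)
  then have T: "T \<in> visit_times S x"
    unfolding T_def using closed_contains_Sup[OF _ bdd closed_visit_times[OF S(1,2) xD]] by blast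
  then obtain s where s: "s > 0" "s \<in> visit_times S (\<phi> T x)"
    using S(3) unfolding recurrent_def visit_times_def by blast
  then have "T + s \<in> visit_times S x"
    using T flow_add[OF xD, of T s] by (simp add: visit_times_def)
  then have "T + s \<le> T" unfolding T_def using bdd by (rule cSup_upper)
  then show False using s(1) by simp
qed

lemma recurrent_visits:
  assumes "compact S" "S \<subseteq> D" "recurrent S" "x \<in> S"
  obtains t where "b \<le> t" "t \<in> visit_times S x"
  using not_bdd_above_visit_times[OF assms] unfolding bdd_above_def by (meson linear)

lemma recurrent_forward_complete:
  assumes "compact S" "S \<subseteq> D" "recurrent S" "x \<in> S"
  shows "{0..} \<subseteq> \<I> x"
proof
  fix b :: real assume "b \<in> {0..}"
  obtain t where t: "b \<le> t" "t \<in> visit_times S x" using recurrent_visits[OF assms] .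
  then have "{0..t} \<subseteq> \<I> x"
    using assms(2,4) by (intro atLeastAtMost_subset_existence_interval) (auto simp: visit_times_def)
  then show "b \<in> \<I> x" using t(1) \<open>b \<in> {0..}\<close> by auto
qed

end

section \<open>Norms and weak pairings\<close>

locale finite_dim_norm =
  fixes N :: "real ^ 'd \<Rightarrow> real"
  assumes vector_norm: "vector_norm N"
begin

lemma N_nonneg: "0 \<le> N x"
  and N_eq_0_iff [simp]: "N x = 0 \<longleftrightarrow> x = 0"
  and N_scaleR [simp]: "N (c *\<^sub>R x) = \<bar>c\<bar> * N x"
  and N_triangle: "N (x + y) \<le> N x + N y"
  using vector_norm by (auto simp: vector_norm_def)

lemma N_zero [simp]: "N 0 = 0"
  by simp

lemma N_pos_iff [simp]: "0 < N x \<longleftrightarrow> x \<noteq> 0"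
  using N_nonneg[of x] by (auto simp: less_le)

lemma N_diff_triangle: "N (x - z) \<le> N (x - y) + N (y - z)"
  using N_triangle[of "x - y" "y - z"] by simp

lemma N_minus_commute: "N (x - y) = N (y - x)"
  using N_scaleR[of "-1" "y - x"] by simp

lemma N_sum: "finite A \<Longrightarrow> N (\<Sum>i\<in>A. g i) \<le> (\<Sum>i\<in>A. N (g i))"
  by (induction rule: finite_induct) (auto intro: order_trans[OF N_triangle])

lemma N_upper_bound:
  obtains C where "C > 0" "\<And>x. N x \<le> C * norm x"
proof -
  define C where "C = (\<Sum>b\<in>(Basis :: (real ^ 'd) set). N b)"
  have "C > 0"
    unfolding C_def by (intro sum_pos) auto
  moreover have "N x \<le> C * norm x" for x
  proof -
    have "N x = N (\<Sum>b\<in>Basis. (x \<bullet> b) *\<^sub>R b)" by (simp add: euclidean_representation)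
    also have "\<dots> \<le> (\<Sum>b\<in>Basis. \<bar>x \<bullet> b\<bar> * N b)"
      using N_sum[OF finite_Basis, of "\<lambda>b. (x \<bullet> b) *\<^sub>R b"] by (simp only: N_scaleR)
    also have "\<dots> \<le> (\<Sum>b\<in>Basis. norm x * N b)"
      by (intro sum_mono mult_right_mono N_nonneg) (rule Basis_le_norm)
    finally show ?thesis by (simp add: C_def sum_distrib_left mult.commute)
  qed
  ultimately show thesis by (rule that)
qed

lemma continuous_on_N [continuous_intros]:
  assumes "continuous_on X g"
  shows "continuous_on X (\<lambda>x. N (g x))"
proof -
  obtain C where C: "C > 0" "\<And>x. N x \<le> C * norm x" using N_upper_bound by blast
  have "C-lipschitz_on UNIV N"
  proof (rule lipschitz_onI)
    fix x y
    have "\<bar>N x - N y\<bar> \<le> N (x - y)"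
      using N_diff_triangle[of x 0 y] N_diff_triangle[of y 0 x] N_minus_commute[of x y] by simp
    then show "dist (N x) (N y) \<le> C * dist x y"
      using C(2)[of "x - y"] by (simp add: dist_norm)
  qed (use C in simp)
  then show ?thesis
    using continuous_on_compose2[OF lipschitz_on_continuous_on assms] by blast
qed

lemma N_lower_bound:
  obtains c where "c > 0" "\<And>x. c * norm x \<le> N x"
proof -
  have "sphere (0 :: real ^ 'd) 1 \<noteq> {}" by simp
  then obtain z where z: "z \<in> sphere 0 1" "\<And>x. x \<in> sphere 0 1 \<Longrightarrow> N z \<le> N x"
    using continuous_attains_inf[OF compact_sphere _ continuous_on_N[OF continuous_on_id]] by metis
  have "N z * norm x \<le> N x" for x
  proof (cases "x = 0")
    case False
    then have "N z \<le> N ((1 / norm x) *\<^sub>R x)" by (intro z(2)) simp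
    then show ?thesis using False by (simp add: field_simps)
  qed simp
  moreover have "N z > 0" using z(1) by auto
  ultimately show thesis using that by blast
qed

lemma compact_norm_ball: "compact (norm_ball N x r)"
proof -
  obtain c where c: "c > 0" "\<And>x. c * norm x \<le> N x" using N_lower_bound by blast
  have "norm (y - x) \<le> r / c" if "y \<in> norm_ball N x r" for y
    using c(2)[of "y - x"] that c(1) by (simp add: norm_ball_def field_simps)
  then have "norm_ball N x r \<subseteq> cball x (r / c)"
    by (auto simp: dist_norm norm_minus_commute)
  moreover have "closed (norm_ball N x r)"
    unfolding norm_ball_def by (intro closed_Collect_le continuous_intros)
  ultimately show ?thesis
    using bounded_subset[OF bounded_cball] compact_eq_bounded_closed by blast
qed

lemma exists_N_diff_eq:
  assumes "0 \<le> r"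
  obtains y where "N (y - x) = r"
proof -
  obtain v :: "real ^ 'd" where "v \<noteq> 0" using nonzero_Basis nonempty_Basis by blast
  then show thesis
    using that[of "x + (r / N v) *\<^sub>R v"] assms N_nonneg[of v] by simp
qed

lemma closure_Diff_norm_ball:
  assumes x: "x \<in> interior S" and "r \<le> N (x - c)" "x \<noteq> c"
  shows "x \<in> closure (S - norm_ball N c r)"
proof (rule Lim_in_closed_set[OF closed_closure])
  have "((\<lambda>\<eta>. x + \<eta> *\<^sub>R (x - c)) \<longlongrightarrow> x + 0 *\<^sub>R (x - c)) (at_right 0)"
    by (intro tendsto_intros)
  then show lim: "((\<lambda>\<eta>. x + \<eta> *\<^sub>R (x - c)) \<longlongrightarrow> x) (at_right 0)" by simp
  show "\<forall>\<^sub>F \<eta> in at_right 0. x + \<eta> *\<^sub>R (x - c) \<in> closure (S - norm_ball N c r)"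
    using topological_tendstoD[OF lim open_interior x] eventually_at_right_less
  proof eventually_elim
    case (elim \<eta>)
    have "0 < \<eta> * N (x - c)" using elim(2) \<open>x \<noteq> c\<close> by simp
    then have "r < (1 + \<eta>) * N (x - c)"
      unfolding distrib_right using \<open>r \<le> N (x - c)\<close> by linarith
    also have "\<dots> = N ((1 + \<eta>) *\<^sub>R (x - c))" using elim(2) by simp
    also have "(1 + \<eta>) *\<^sub>R (x - c) = x + \<eta> *\<^sub>R (x - c) - c" by (simp add: algebra_simps)
    finally have "x + \<eta> *\<^sub>R (x - c) \<in> S - norm_ball N c r"
      using subsetD[OF interior_subset elim(1)] by (simp add: norm_ball_def)
    then show ?case by (rule subsetD[OF closure_subset])
  qed
qed simp

lemma locally_lipschitz_imp_lipschitz_on: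
  assumes f: "locally_lipschitz N D f" and K: "compact K" "K \<subseteq> D"
  shows "\<exists>M. M-lipschitz_on K f"
proof -
  obtain L where L: "L \<ge> 0" "\<And>x y. x \<in> K \<Longrightarrow> y \<in> K \<Longrightarrow> N (f y - f x) \<le> L * N (y - x)"
    using f K unfolding locally_lipschitz_def by metis
  obtain c C where c: "c > 0" "C > 0" "\<And>x. c * norm x \<le> N x" "\<And>x. N x \<le> C * norm x"
    using N_lower_bound N_upper_bound by metis
  have "(L * C / c)-lipschitz_on K f"
  proof (rule lipschitz_onI)
    fix x y assume "x \<in> K" "y \<in> K"
    then have "c * norm (f x - f y) \<le> L * N (x - y)"
      using c(3)[of "f x - f y"] L(2)[of y x] by simp
    also have "\<dots> \<le> L * (C * norm (x - y))" by (intro mult_left_mono c L)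
    finally show "dist (f x) (f y) \<le> L * C / c * dist x y"
      using c(1) by (simp add: dist_norm field_simps)
  qed (use L c in simp)
  then show ?thesis ..
qed

end

lemma Least_mem_closed:
  fixes Q :: "real set"
  assumes "closed Q" "Q \<noteq> {}" "bdd_below Q"
  shows "(LEAST x. x \<in> Q) \<in> Q"
proof -
  have "Inf Q \<in> Q" using assms by (intro closed_contains_Inf)
  moreover have "(LEAST x. x \<in> Q) = Inf Q"
    using calculation assms(3) by (intro Least_equality) (auto intro: cInf_lower)
  ultimately show ?thesis by simp
qed

locale weak_pairing_norm = finite_dim_norm N
  for N :: "real ^ 'd \<Rightarrow> real" +
  fixes P :: "real ^ 'd \<Rightarrow> real ^ 'd \<Rightarrow> real"
  assumes associated_weak_pairing: "associated_weak_pairing N P"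
begin

lemma P_add_left_le: "P (x + y) z \<le> P x z + P y z"
  using associated_weak_pairing by (auto simp: associated_weak_pairing_def weak_pairing_def)

lemma P_le_N_mult_N: "P x y \<le> N x * N y"
  using associated_weak_pairing abs_le_D1
  unfolding associated_weak_pairing_def weak_pairing_def by metis

lemma upper_right_dini_N:
  assumes c: "\<And>t. t \<in> {a<..<b} \<Longrightarrow> (c has_vector_derivative c' t) (at t)"
    and t: "t \<in> {a<..<b}" and "c t \<noteq> 0"
  shows "upper_right_dini (\<lambda>s. N (c s)) t = ereal (P (c' t) (c t) / N (c t))"
proof -
  have "ereal (N (c t)) * upper_right_dini (\<lambda>s. N (c s)) t = ereal (P (c' t) (c t))"
    using associated_weak_pairing c t
    unfolding associated_weak_pairing_def curve_norm_derivative_formula_def by blast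
  moreover have "N (c t) > 0" using \<open>c t \<noteq> 0\<close> by simp
  ultimately show ?thesis
    by (cases "upper_right_dini (\<lambda>s. N (c s)) t") (auto simp: field_simps)
qed

text \<open>The constant is a \<open>LEAST\<close> over the reals, meaningful only if the minimum is attained.\<close>

lemma one_sided_lipschitz_constant_bound:
  assumes lip: "\<And>x y. x \<in> K \<Longrightarrow> y \<in> K \<Longrightarrow> N (f y - f x) \<le> M * N (y - x)"
    and pq: "p \<in> K" "q \<in> K" "p \<noteq> q" and xy: "x \<in> K" "y \<in> K"
  shows "P (f y - f x) (y - x) \<le> one_sided_lipschitz_constant N P f K * (N (y - x))\<^sup>2"
proof -
  define Q where "Q = {L. \<forall>x\<in>K. \<forall>y\<in>K. P (f y - f x) (y - x) \<le> L * (N (y - x))\<^sup>2}"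
  have "P (f y - f x) (y - x) \<le> M * (N (y - x))\<^sup>2" if "x \<in> K" "y \<in> K" for x y
  proof -
    have "P (f y - f x) (y - x) \<le> N (f y - f x) * N (y - x)" by (rule P_le_N_mult_N)
    also have "\<dots> \<le> M * N (y - x) * N (y - x)" by (intro mult_right_mono lip that N_nonneg)
    finally show ?thesis by (simp add: power2_eq_square)
  qed
  then have "M \<in> Q" by (simp add: Q_def)
  moreover have "bdd_below Q"
  proof (rule bdd_belowI)
    fix L assume "L \<in> Q"
    then have "P (f q - f p) (q - p) \<le> L * (N (q - p))\<^sup>2" using pq by (simp add: Q_def)
    then show "P (f q - f p) (q - p) / (N (q - p))\<^sup>2 \<le> L"
      using pq(3) by (simp add: pos_divide_le_eq)
  qed
  moreover have "closed Q"
  proof -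
    have "Q = (\<Inter>x\<in>K. \<Inter>y\<in>K. {L. P (f y - f x) (y - x) \<le> L * (N (y - x))\<^sup>2})"
      by (auto simp: Q_def)
    then show ?thesis
      by (simp only:) (intro closed_INT ballI closed_Collect_le continuous_intros)
  qed
  ultimately have "(LEAST L. L \<in> Q) \<in> Q" by (intro Least_mem_closed) auto
  then show ?thesis using xy by (simp add: Q_def one_sided_lipschitz_constant_def)
qed

end

locale weak_pairing_ode = weak_pairing_norm N P + lipschitz_ode D f
  for N :: "real ^ 'd \<Rightarrow> real" and P and D :: "(real ^ 'd) set" and f
begin

lemma flow_displacement:
  assumes y: "y \<in> D" and "0 \<le> b" and ex: "{0..b} \<subseteq> \<I> y"
    and K: "\<And>t. t \<in> {0..b} \<Longrightarrow> \<phi> t y \<in> K"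
    and L: "\<And>x z. x \<in> K \<Longrightarrow> z \<in> K \<Longrightarrow> P (f z - f x) (z - x) \<le> L * (N (z - x))\<^sup>2"
  shows "N (\<phi> b y - y) \<le> N (f y) * growth_factor b L"
proof -
  have "upper_right_dini (\<lambda>t. N (\<phi> t y - y)) t \<le> ereal (L * N (\<phi> t y - y) + N (f y))"
    if t: "t \<in> {0<..<b}" and pos: "N (\<phi> t y - y) > 0" for t
  proof -
    define z where "z = \<phi> t y"
    have "((\<lambda>t. \<phi> t y - y) has_vector_derivative f (\<phi> s y)) (at s)" if "s \<in> {0<..<b}" for s
    proof -
      have "s \<in> \<I> y" using ex that by auto
      from has_vector_derivative_diff[OF flow_has_vector_derivative[OF y this]
          has_vector_derivative_const]
      show ?thesis by simp
    qed
    then have "upper_right_dini (\<lambda>t. N (\<phi> t y - y)) t = ereal (P (f z) (z - y) / N (z - y))"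
      unfolding z_def using t pos by (intro upper_right_dini_N) auto
    moreover have "P (f z) (z - y) \<le> (L * N (z - y) + N (f y)) * N (z - y)"
    proof -
      have "P (f z) (z - y) \<le> P (f z - f y) (z - y) + P (f y) (z - y)"
        using P_add_left_le[of "f z - f y" "f y"] by simp
      also have "\<dots> \<le> L * (N (z - y))\<^sup>2 + N (f y) * N (z - y)"
        using K[of 0] K[of t] t flow_0[OF y] unfolding z_def
        by (intro add_mono L P_le_N_mult_N) auto
      finally show ?thesis by (simp add: power2_eq_square distrib_right)
    qed
    ultimately show ?thesis
      using pos unfolding z_def by (simp add: pos_divide_le_eq del: N_pos_iff)
  qed
  moreover have "continuous_on {0..b} (\<lambda>t. N (\<phi> t y - y))"
    by (intro continuous_intros continuous_on_flow_time y ex)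
  ultimately show ?thesis
    using dini_gronwall[OF \<open>0 \<le> b\<close>, of "\<lambda>t. N (\<phi> t y - y)" "N (f y)" L] flow_0[OF y] N_nonneg
    by simp
qed

end

section \<open>The norm as a strict recurrent Lyapunov function\<close>

locale norm_SRLF = weak_pairing_norm N P
  for N :: "real ^ 'd \<Rightarrow> real" and P +
  fixes D S :: "(real ^ 'd) set" and f :: "real ^ 'd \<Rightarrow> real ^ 'd"
    and xs :: "real ^ 'd" and \<epsilon> \<tau> :: real
  assumes open_domain: "open D" and locally_lipschitz: "locally_lipschitz N D f"
    and \<epsilon>_pos: "\<epsilon> > 0" and compact_S: "compact S" and S_subset_D: "S \<subseteq> D"
    and ball_subset_interior: "norm_ball N xs \<epsilon> \<subseteq> interior S" and \<tau>_pos: "\<tau> > 0"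
    and SRLF: "eps_SRLF N D f xs \<epsilon> S \<tau> (\<lambda>x. N (x - xs))"
begin

sublocale weak_pairing_ode N P D f
  using open_domain locally_lipschitz_imp_lipschitz_on[OF locally_lipschitz] by unfold_locales

abbreviation B :: "(real ^ 'd) set" where "B \<equiv> norm_ball N xs \<epsilon>"

abbreviation tube :: "(real ^ 'd) set" where "tube \<equiv> reachable_tube D f \<tau> B"

definition L :: real where "L = one_sided_lipschitz_constant N P f (closure tube)"

definition F :: real where "F = (SUP x\<in>B. N (f x))"

lemma B_subset_S: "B \<subseteq> S"
  using ball_subset_interior interior_subset by (rule subset_trans)

lemma B_subset_D: "B \<subseteq> D"
  using B_subset_S S_subset_D by (rule subset_trans)

lemma SRLF_decrease:
  assumes x: "x \<in> S" and far: "\<epsilon> \<le> N (x - xs)"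
  obtains s where "0 < s" "s \<le> \<tau>" "s \<in> visit_times S x" "N (\<phi> s x - xs) < N (x - xs)"
proof -
  have "x \<in> closure (S - B)"
  proof (cases "x \<in> interior S")
    case True
    then show ?thesis using far \<epsilon>_pos by (intro closure_Diff_norm_ball) auto
  next
    case False
    then have "x \<in> S - B" using x ball_subset_interior by blast
    then show ?thesis by (rule subsetD[OF closure_subset])
  qed
  then obtain s where "s \<in> containment_times D f S x \<tau>" "N (\<phi> s x - xs) < N (x - xs)"
    using SRLF unfolding eps_SRLF_def by blast
  then show thesis using that[of s] by (simp add: containment_times_def visit_times_def)
qed

lemma recurrent_S: "recurrent S"
  unfolding recurrent_def
proof
  fix x assume x: "x \<in> S"
  show "\<exists>t>0. t \<in> visit_times S x"
  proof (cases "\<epsilon> \<le> N (x - xs)")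
    case True
    then show ?thesis using SRLF_decrease[OF x] by metis
  next
    case False
    then have "x \<in> interior S" using ball_subset_interior by (auto simp: norm_ball_def)
    then show ?thesis using visit_times_interior[OF S_subset_D] by metis
  qed
qed

lemma forward_complete: "x \<in> S \<Longrightarrow> {0..} \<subseteq> \<I> x"
  using recurrent_forward_complete[OF compact_S S_subset_D recurrent_S] .

lemma flow_add_S:
  assumes "x \<in> S" "0 \<le> t" "0 \<le> s"
  shows "\<phi> (t + s) x = \<phi> s (\<phi> t x)"
  using assms S_subset_D forward_complete by (intro flow_add_nonneg) auto

lemma continuous_on_distance_along_flow:
  assumes "x \<in> S" "X \<subseteq> {0..}"
  shows "continuous_on X (\<lambda>t. N (\<phi> t x - xs))"
  using assms S_subset_D forward_complete
  by (intro continuous_intros continuous_on_flow_time) blast+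

lemma compact_tube: "compact tube"
proof (rule compact_reachable_tube[OF compact_norm_ball B_subset_D])
  show "{0..\<tau>} \<subseteq> \<I> x" if "x \<in> B" for x
    using forward_complete[OF subsetD[OF B_subset_S that]] by (rule subset_trans[rotated]) auto
qed (use \<tau>_pos in simp)

lemma one_sided_lipschitz_tube:
  assumes "x \<in> tube" "y \<in> tube"
  shows "P (f y - f x) (y - x) \<le> L * (N (y - x))\<^sup>2"
proof -
  have tube: "closure tube = tube" using compact_tube by (simp add: compact_imp_closed)
  obtain q where q: "N (q - xs) = \<epsilon>" using exists_N_diff_eq[of \<epsilon> xs] \<epsilon>_pos by auto
  have B_tube: "B \<subseteq> tube" using B_subset_D \<tau>_pos by (intro subset_reachable_tube) auto
  have pq: "xs \<in> tube" "q \<in> tube" "xs \<noteq> q"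
    using subsetD[OF B_tube] q \<epsilon>_pos by (auto simp: norm_ball_def)
  obtain M where M: "\<And>x y. x \<in> tube \<Longrightarrow> y \<in> tube \<Longrightarrow> N (f y - f x) \<le> M * N (y - x)"
    using locally_lipschitz compact_tube reachable_tube_subset[OF B_subset_D]
    unfolding locally_lipschitz_def by metis
  show ?thesis
    unfolding L_def tube using M pq assms by (rule one_sided_lipschitz_constant_bound)
qed

lemma N_vector_field_le_F:
  assumes "x \<in> B"
  shows "N (f x) \<le> F"
proof -
  have "compact ((\<lambda>x. N (f x)) ` B)"
    by (intro compact_continuous_image continuous_intros compact_norm_ball
        continuous_on_vector_field B_subset_D)
  then have "bdd_above ((\<lambda>x. N (f x)) ` B)"
    by (intro bounded_imp_bdd_above compact_imp_bounded)
  then show ?thesis unfolding F_def using assms by (intro cSUP_upper)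
qed

lemma F_nonneg: "0 \<le> F"
  using N_vector_field_le_F[of xs] N_nonneg[of "f xs"] \<epsilon>_pos by (simp add: norm_ball_def)

lemma excursion_from_B:
  assumes x: "x \<in> B" and "0 \<le> t" and out: "\<epsilon> < N (\<phi> t x - xs)"
  obtains t\<^sub>0 where "0 \<le> t\<^sub>0" "t\<^sub>0 \<le> t" "t \<le> t\<^sub>0 + \<tau>" "N (\<phi> t\<^sub>0 x - xs) = \<epsilon>"
proof -
  have xS: "x \<in> S" using x B_subset_S by blast
  have "N (\<phi> 0 x - xs) \<le> \<epsilon>" using x B_subset_D by (auto simp: flow_0 norm_ball_def)
  then obtain t\<^sub>0 where t\<^sub>0: "0 \<le> t\<^sub>0" "t\<^sub>0 < t" "N (\<phi> t\<^sub>0 x - xs) = \<epsilon>"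
    and outside: "\<And>s. t\<^sub>0 < s \<Longrightarrow> s \<le> t \<Longrightarrow> \<epsilon> < N (\<phi> s x - xs)"
    using last_time_at_level[OF continuous_on_distance_along_flow[OF xS, of "{0..t}"] \<open>0 \<le> t\<close> _ out]
    by auto
  have "\<phi> t\<^sub>0 x \<in> S" using t\<^sub>0(3) B_subset_S by (auto simp: norm_ball_def)
  then obtain s where s: "0 < s" "s \<le> \<tau>" "N (\<phi> s (\<phi> t\<^sub>0 x) - xs) < \<epsilon>"
    using SRLF_decrease[of "\<phi> t\<^sub>0 x"] t\<^sub>0(3) by auto
  then have "\<not> t\<^sub>0 + s \<le> t"
    using outside[of "t\<^sub>0 + s"] flow_add_S[OF xS t\<^sub>0(1), of s] by auto
  then show thesis using that[of t\<^sub>0] t\<^sub>0 s(2) by simp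
qed

lemma displacement_from_B:
  assumes y: "y \<in> B" and r: "0 \<le> r" "r \<le> \<tau>"
  shows "N (\<phi> r y - y) \<le> F * growth_factor \<tau> L"
proof -
  have ex: "{0..} \<subseteq> \<I> y" using y B_subset_S forward_complete by blast
  have "N (\<phi> r y - y) \<le> N (f y) * growth_factor r L"
  proof (rule flow_displacement)
    show "\<phi> t y \<in> tube" if "t \<in> {0..r}" for t
      using that r y ex unfolding reachable_tube_def
      by (intro CollectI exI[of _ t] exI[of _ y]) auto
    show "P (f z - f x) (z - x) \<le> L * (N (z - x))\<^sup>2" if "x \<in> tube" "z \<in> tube" for x z
      using that by (rule one_sided_lipschitz_tube)
  qed (use y B_subset_D r ex in auto)
  also have "\<dots> \<le> F * growth_factor \<tau> L"
    using N_vector_field_le_F[OF y] F_nonneg r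
    by (intro mult_mono growth_factor_mono growth_factor_nonneg)
  finally show ?thesis .
qed

lemma distance_from_B:
  assumes x: "x \<in> B" and "0 \<le> t"
  shows "N (\<phi> t x - xs) \<le> \<epsilon> + F * growth_factor \<tau> L"
proof (cases "N (\<phi> t x - xs) \<le> \<epsilon>")
  case True
  then show ?thesis
    using F_nonneg growth_factor_nonneg[of \<tau> L] \<tau>_pos by (simp add: add_increasing2)
next
  case False
  then obtain t\<^sub>0 where t\<^sub>0: "0 \<le> t\<^sub>0" "t\<^sub>0 \<le> t" "t \<le> t\<^sub>0 + \<tau>" "N (\<phi> t\<^sub>0 x - xs) = \<epsilon>"
    using excursion_from_B[OF x \<open>0 \<le> t\<close>] by auto
  define y where "y = \<phi> t\<^sub>0 x"
  have "\<phi> t x = \<phi> (t - t\<^sub>0) y"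
    using flow_add_S[of x t\<^sub>0 "t - t\<^sub>0"] x B_subset_S t\<^sub>0 by (auto simp: y_def)
  moreover have "N (\<phi> (t - t\<^sub>0) y - y) \<le> F * growth_factor \<tau> L"
    using t\<^sub>0 by (intro displacement_from_B) (auto simp: y_def norm_ball_def)
  ultimately show ?thesis
    using N_diff_triangle[of "\<phi> t x" xs y] t\<^sub>0(4) by (simp add: y_def)
qed

text \<open>The \<open>\<omega>\<close>-limit set is taken along all times, not only visits to \<open>S\<close>: a return to the boundary
  of \<open>S\<close> need not persist for nearby initial points.\<close>

lemma orbit_enters_B:
  assumes x: "x \<in> S"
  obtains t where "0 \<le> t" "\<phi> t x \<in> B"
proof -
  have "\<exists>t\<ge>T. \<phi> t x \<in> S" for T
    using recurrent_visits[OF compact_S S_subset_D recurrent_S x, of T]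
    by (auto simp: visit_times_def)
  then have "S \<inter> omega_limit_set x \<noteq> {}"
    using compact_S by (intro omega_limit_set_Int_compact_nonempty)
  moreover have "continuous_on S (\<lambda>x. N (x - xs))" by (intro continuous_intros)
  ultimately obtain p where p: "p \<in> S" "p \<in> omega_limit_set x"
    and min: "\<And>s. 0 \<le> s \<Longrightarrow> s \<in> \<I> p \<Longrightarrow> \<phi> s p \<in> S \<Longrightarrow> N (p - xs) \<le> N (\<phi> s p - xs)"
    using omega_limit_set_minimum[OF _ forward_complete[OF x] compact_S S_subset_D,
        where V = "\<lambda>x. N (x - xs)"] x S_subset_D by blast
  have "N (p - xs) < \<epsilon>"
  proof (rule ccontr)
    assume "\<not> N (p - xs) < \<epsilon>"
    then obtain s where "s \<in> visit_times S p" "N (\<phi> s p - xs) < N (p - xs)"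
      using SRLF_decrease[OF p(1)] by auto
    then show False using min[of s] by (auto simp: visit_times_def)
  qed
  moreover have "open {y. N (y - xs) < \<epsilon>}" by (intro open_Collect_less continuous_intros)
  ultimately obtain t where "0 \<le> t" "\<phi> t x \<in> {y. N (y - xs) < \<epsilon>}"
    using omega_limit_set_visits_open[OF p(2)] by blast
  then show thesis using that[of t] by (simp add: norm_ball_def)
qed

lemma Limsup_distance_le:
  assumes x: "x \<in> S"
  shows "Limsup at_top (\<lambda>t. ereal (N (\<phi> t x - xs))) \<le> ereal (\<epsilon> + F * growth_factor \<tau> L)"
proof (rule Limsup_bounded)
  obtain t\<^sub>0 where t\<^sub>0: "0 \<le> t\<^sub>0" "\<phi> t\<^sub>0 x \<in> B" using orbit_enters_B[OF x] .
  show "\<forall>\<^sub>F t in at_top. ereal (N (\<phi> t x - xs)) \<le> ereal (\<epsilon> + F * growth_factor \<tau> L)"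
    using eventually_ge_at_top[of t\<^sub>0]
  proof eventually_elim
    case (elim t)
    then show ?case
      using distance_from_B[OF t\<^sub>0(2), of "t - t\<^sub>0"] flow_add_S[OF x t\<^sub>0(1), of "t - t\<^sub>0"] by simp
  qed
qed

end

theorem theorem6:
  fixes N :: "real ^ 'd \<Rightarrow> real"
    and P :: "real ^ 'd \<Rightarrow> real ^ 'd \<Rightarrow> real"
    and D S :: "(real ^ 'd) set"
    and f :: "real ^ 'd \<Rightarrow> real ^ 'd"
    and xs :: "real ^ 'd"
    and \<epsilon> \<tau> :: real
  assumes "vector_norm N"
    and "associated_weak_pairing N P"
    and "open D"
    and "locally_lipschitz N D f"
    and "xs \<in> D" and "f xs = 0"
    and "\<epsilon> > 0"
    and "compact S" and "S \<subseteq> D"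
    and "norm_ball N xs \<epsilon> \<subseteq> interior S"
    and "\<tau> > 0"
    and "eps_SRLF N D f xs \<epsilon> S \<tau> (\<lambda>x. N (x - xs))"
  shows "practically_asymptotically_stable N D f xs S
           (\<epsilon> + (SUP x\<in>norm_ball N xs \<epsilon>. N (f x)) *
              growth_factor \<tau>
                (one_sided_lipschitz_constant N P f
                   (closure (reachable_tube D f \<tau> (norm_ball N xs \<epsilon>)))))"
proof -
  interpret norm_SRLF N P D S f xs \<epsilon> \<tau>
    using assms by unfold_locales
  show ?thesis
    unfolding practically_asymptotically_stable_def L_def[symmetric] F_def[symmetric]
  proof (intro conjI exI[of _ \<epsilon>] allI ballI impI)
    show "0 < \<epsilon> + F * growth_factor \<tau> L"
      using \<epsilon>_pos F_nonneg growth_factor_nonneg[of \<tau> L] \<tau>_pos by (simp add: add_pos_nonneg)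
    fix x assume "N (x - xs) \<le> \<epsilon>"
    then have x: "x \<in> B" by (simp add: norm_ball_def)
    then show "{0..} \<subseteq> \<I> x" using B_subset_S forward_complete by blast
    show "N (\<phi> t x - xs) \<le> \<epsilon> + F * growth_factor \<tau> L" if "0 \<le> t" for t
      using x that by (rule distance_from_B)
  qed (use \<epsilon>_pos forward_complete Limsup_distance_le in auto)
qed

end
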